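(* Let $(\lambda_k)_{k\in\mathbb{N}}$ be a uniqueness sequence for the (one-dimensional) Laplace transform with $\Re\lambda_k>0$ for all $k\in\mathbb{N}$, and let $\gamma\in(0,1)$. If $\lim_{k\to+\infty}\Re\lambda_k=+\infty$, then $(\lambda_k^\gamma)_{k\in\mathbb{N}}$ is a uniqueness sequence for the (one-dimensional) Laplace transform and $$\sum_{k=1}^{+\infty}\left[1-\left|\frac{\lambda_k^\gamma-1}{\lambda_k^\gamma+1}\right|\right]=+\infty.$$
   Context: Powers $\lambda^\gamma$ for $\Re\lambda>0$ are taken with the principal branch. For a locally integrable $f:[0,+\infty)\to\mathbb{C}$, write $\hat f(\lambda)=\lim_{t\to+\infty}\int_0^te^{-\lambda s}f(s)\,ds$ when the limit exists, and $\mathrm{abs}(f)=\inf\{\Re\lambda:\hat f(\lambda)\text{ exists}\}$. A complex sequence $(\lambda_k)_{k\in\mathbb{N}}$ is a uniqueness sequence for the Laplace transform if for every locally integrable $f:[0,+\infty)\to\mathbb{C}$ such that $\mathrm{abs}(f)<\Re\lambda_k$ and $\hat f(\lambda_k)=0$ for all $k\in\mathbb{N}$, we have $f=0$ a.e. *)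

theory Defs
  imports "HOL-Analysis.Analysis"
begin

text \<open>A function \<open>[0,+\<infinity>) \<rightarrow> \<complex>\<close> is rendered as a total function on the reals
  of which only the values on \<open>{0..}\<close> are ever used. Integrability and null sets refer to the
  completed Lebesgue measure, so \<open>f\<close> need only be Lebesgue (not Borel) measurable.\<close>

definition locally_integrable :: "(real \<Rightarrow> complex) \<Rightarrow> bool" where
  "locally_integrable f \<longleftrightarrow> (\<forall>t\<ge>0. set_integrable lebesgue {0..t} f)"

text \<open>\<open>has_laplace_transform f z L\<close>: the limit defining the transform of \<open>f\<close> at \<open>z\<close>
  exists (as a possibly only conditionally convergent improper integral) and equals \<open>L\<close>.\<close>

definition has_laplace_transform :: "(real \<Rightarrow> complex) \<Rightarrow> complex \<Rightarrow> complex \<Rightarrow> bool" where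
  "has_laplace_transform f z L \<longleftrightarrow>
     ((\<lambda>t. LINT s:{0..t}|lebesgue. exp (- z * of_real s) * f s) \<longlongrightarrow> L) at_top"

text \<open>Extended-real valued: \<open>\<infinity>\<close> if the transform exists nowhere,
  \<open>-\<infinity>\<close> if it exists everywhere.\<close>

definition laplace_abscissa :: "(real \<Rightarrow> complex) \<Rightarrow> ereal" where
  "laplace_abscissa f = Inf {ereal (Re z) | z. \<exists>L. has_laplace_transform f z L}"

definition laplace_uniqueness_sequence :: "(nat \<Rightarrow> complex) \<Rightarrow> bool" where
  "laplace_uniqueness_sequence l \<longleftrightarrow>
     (\<forall>f. locally_integrable f \<and>
          (\<forall>k. laplace_abscissa f < ereal (Re (l k)) \<and> has_laplace_transform f (l k) 0)
        \<longrightarrow> (AE t in lebesgue. t \<ge> 0 \<longrightarrow> f t = 0))"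

end

theory Submission
  imports Defs "HOL-Complex_Analysis.Complex_Analysis" "HOL-Real_Asymp.Real_Asymp" "HOL-Probability.Sinc_Integral"
begin

text \<open>Both conclusions rest on the Blaschke condition. Let \<open>\<beta>(w) = Re w / (1 + |w|\<^sup>2)\<close> for \<open>w\<close> in the
  right half-plane. A nonzero bounded analytic function on the half-plane can vanish on a set \<open>S\<close>
  only if \<open>\<beta>\<close> is summable over \<open>S\<close>, and if it is summable and \<open>Re\<close> is bounded below by a positive
  constant on \<open>S\<close>, a Blaschke product vanishes on \<open>S\<close>. Each half of this dichotomy is transported
  to Laplace transforms.

  The Blaschke product yields \<open>uniqueness_imp_blaschke_divergence\<close>: divided by a quadratic factor it
  is the Laplace transform of a nonzero bounded function, so for a uniqueness sequence \<open>l\<close> the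
  sum of \<open>\<beta>\<close> over the values of \<open>l\<close> diverges. Since \<open>\<gamma> < 1\<close>, the power \<open>z\<^sup>\<gamma>\<close> stays in a proper
  subsector of the half-plane, where \<open>\<beta>(z\<^sup>\<gamma>)\<close> is at least a constant times \<open>\<beta>(z)\<close>
  (\<open>blaschke_weight_le_powr\<close>). Hence the sum of \<open>\<beta>(z\<^sup>\<gamma>)\<close> over the values \<open>z\<close> of \<open>l\<close> diverges too, and with
  it the series in the theorem, because \<open>1 - |(w - 1) / (w + 1)|\<close> is at least \<open>\<beta>(w) / 2\<close>.

  For the uniqueness of \<open>l\<^sub>k\<^sup>\<gamma>\<close>, let the transform of \<open>f\<close> converge at \<open>z\<^sub>0\<close> and vanish at all
  \<open>l\<^sub>k\<^sup>\<gamma>\<close>. Integration by parts turns it, to the right of \<open>z\<^sub>0\<close>, into a linear factor times a function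
  that is bounded on \<open>Re z > Re z\<^sub>0 + 1\<close>. This half-plane contains all but finitely many of the zeros, because \<open>Re l\<^sub>k\<^sup>\<gamma>\<close>
  tends to infinity, and neither dropping finitely many points nor translating the rest destroys the
  divergence. So the bounded function is zero, and \<open>f = 0\<close> almost everywhere by Lerch's argument
  (\<open>laplace_blaschke_uniqueness\<close>).

  Sums run over the set of values rather than over the indices, since a sequence may repeat values
  and the property of being a uniqueness sequence only sees the set.\<close>

section \<open>Zeros of bounded analytic functions on a half-plane\<close>

text \<open>A zero at \<open>a\<close> can be divided out by a Moebius factor without increasing the bound: moving \<open>a\<close> to the
  origin reduces this to the Schwarz lemma.\<close>

lemma disc_zero_factor:
  assumes hol: "f holomorphic_on ball 0 1"
    and bound: "\<And>z. norm z < 1 \<Longrightarrow> norm (f z) \<le> 1"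
    and a: "norm a < 1" "f a = 0"
  obtains g where "g holomorphic_on ball 0 1"
    and "\<And>z. norm z < 1 \<Longrightarrow> norm (g z) \<le> 1"
    and "\<And>z. norm z < 1 \<Longrightarrow> f z = Moebius_function 0 a z * g z"
proof -
  let ?\<phi> = "Moebius_function 0 a" and ?\<psi> = "Moebius_function 0 (- a)"
  define F where "F = f \<circ> ?\<psi>"
  have hol\<phi>: "?\<phi> holomorphic_on ball 0 1" and hol\<psi>: "?\<psi> holomorphic_on ball 0 1"
    using a by (auto intro: Moebius_function_holomorphic)
  have \<phi>1: "norm (?\<phi> z) < 1" and \<psi>1: "norm (?\<psi> z) < 1" if "norm z < 1" for z
    using Moebius_function_norm_lt_1 a that by auto
  have holF: "F holomorphic_on ball 0 1"
    unfolding F_def by (rule holomorphic_on_compose_gen[OF hol\<psi> hol]) (use \<psi>1 in auto)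
  have F0: "F 0 = 0"
    using a by (simp add: F_def Moebius_function_of_zero)
  have F1: "norm (F z) \<le> 1" if "norm z < 1" for z
    using that \<psi>1 bound by (simp add: F_def)
  obtain h where holh: "h holomorphic_on ball 0 1"
    and Fh: "\<And>z. norm z < 1 \<Longrightarrow> F z = z * h z" and dF: "deriv F 0 = h 0"
    using Schwarz3[OF holF F0] by blast
  \<comment> \<open>The Schwarz lemma wants a strict bound, so it is applied to \<open>c * F\<close> for \<open>c < 1\<close>.\<close>
  have h1: "norm (h z) \<le> 1" if z: "norm z < 1" for z
  proof (rule field_le_mult_one_interval)
    fix c :: real assume c: "0 < c" "c < 1"
    let ?F = "\<lambda>z. of_real c * F z"
    have hol': "?F holomorphic_on ball 0 1"
      by (intro holomorphic_intros holF)
    have less: "norm (?F z) < 1" if "norm z < 1" for z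
      using F1[OF that] c by (simp add: norm_mult) (metis mult_left_le_one_le mult_le_one
        order.strict_trans1 mult.commute norm_ge_zero mult_right_le_one_le less_eq_real_def)
    have F0': "?F 0 = 0" by (simp add: F0)
    note Schwarz = Schwarz_Lemma(1,2)[OF hol' F0' less]
    show "c * norm (h z) \<le> 1"
    proof (cases "z = 0")
      case True
      have "deriv ?F 0 = of_real c * deriv F 0"
        by (rule deriv_cmult) (use holF in \<open>auto intro: holomorphic_on_imp_differentiable_at\<close>)
      then show ?thesis
        using Schwarz(2)[OF _ z] c True dF by (simp add: norm_mult)
    next
      case False
      then show ?thesis
        using Schwarz(1)[OF _ z] c Fh[OF z] by (simp add: norm_mult field_simps)
    qed
  qed
  show thesis
  proof
    show "h \<circ> ?\<phi> holomorphic_on ball 0 1"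
      by (rule holomorphic_on_compose_gen[OF hol\<phi> holh]) (use \<phi>1 in auto)
    show "norm ((h \<circ> ?\<phi>) z) \<le> 1" if "norm z < 1" for z
      using h1 \<phi>1 that by simp
    show "f z = ?\<phi> z * (h \<circ> ?\<phi>) z" if "norm z < 1" for z
    proof -
      have "?\<psi> (?\<phi> z) = z"
        using Moebius_function_compose[of "-a" a z] a that by simp
      then show ?thesis
        using Fh[OF \<phi>1[OF that]] by (simp add: F_def)
    qed
  qed
qed

lemma disc_zeros_product_bound:
  assumes "finite S" "S \<subseteq> ball 0 1" "f holomorphic_on ball 0 1"
    and "\<And>z. norm z < 1 \<Longrightarrow> norm (f z) \<le> 1" "\<And>a. a \<in> S \<Longrightarrow> f a = 0"
  shows "norm (f 0) \<le> (\<Prod>a\<in>S. norm a)"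
  using assms
proof (induction S arbitrary: f rule: finite_induct)
  case empty
  then show ?case by simp
next
  case (insert a S)
  obtain g where g: "g holomorphic_on ball 0 1"
    "\<And>z. norm z < 1 \<Longrightarrow> norm (g z) \<le> 1"
    "\<And>z. norm z < 1 \<Longrightarrow> f z = Moebius_function 0 a z * g z"
    by (rule disc_zero_factor[of f a]) (use insert.prems in auto)
  have "g b = 0" if "b \<in> S" for b
  proof -
    have b: "norm b < 1" "norm a < 1" "b \<noteq> a"
      using insert that by auto
    have "Moebius_function 0 a b \<noteq> 0"
    proof
      assume *: "Moebius_function 0 a b = 0"
      have "b = Moebius_function 0 (- a) (Moebius_function 0 a b)"
        using Moebius_function_compose[of "-a" a b] b by simp
      also have "\<dots> = a" by (simp add: * Moebius_function_of_zero)
      finally show False using b by simp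
    qed
    then show ?thesis using g(3)[OF b(1)] insert.prems that by simp
  qed
  then have "norm (g 0) \<le> (\<Prod>a\<in>S. norm a)"
    using insert.IH[of g] insert.prems g by auto
  then show ?case
    using insert.hyps g(3)[of 0]
    by (simp add: norm_mult Moebius_function_of_zero mult_left_mono)
qed

text \<open>The Cayley map sending \<open>0\<close> to \<open>x\<close> carries the zeros to the points \<open>(w - x) / (w + x)\<close> of the disc,
  so the value at \<open>x\<close> is controlled by the value at the centre of the disc.\<close>

lemma halfplane_zeros_product_bound:
  fixes x :: real and S :: "complex set"
  assumes "finite S" and S: "\<And>w. w \<in> S \<Longrightarrow> 0 < Re w \<and> G w = 0"
    and hol: "G holomorphic_on {w. 0 < Re w}"
    and bound: "\<And>w. 0 < Re w \<Longrightarrow> norm (G w) \<le> 1" and x: "0 < x"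
  shows "norm (G x) \<le> (\<Prod>w\<in>S. norm ((w - x) / (w + x)))"
proof -
  let ?c = "\<lambda>z::complex. x * (1 + z) / (1 - z)" and ?d = "\<lambda>w::complex. (w - x) / (w + x)"
  have Re_c: "0 < Re (?c z)" if "norm z < 1" for z
  proof -
    have "z \<noteq> 1" using that by auto
    then have n0: "(norm (1 - z))\<^sup>2 > 0" by simp
    have "Re (?c z) = x * (1 - (norm z)\<^sup>2) / (norm (1 - z))\<^sup>2"
      unfolding cmod_power2 Re_divide by (simp add: algebra_simps power2_eq_square)
    moreover have "(norm z)\<^sup>2 < 1" using that by (simp add: power_less_one_iff abs_square_less_1)
    ultimately show ?thesis using n0 x by simp
  qed
  have nz: "w + x \<noteq> 0" if "0 < Re w" for w
    using that x by (auto simp: complex_eq_iff)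
  have d1: "norm (?d w) < 1" if "0 < Re w" for w
  proof -
    have "(norm (w - x))\<^sup>2 < (norm (w + x))\<^sup>2"
      unfolding cmod_power2 using that x by (simp add: power2_eq_square algebra_simps)
    then have "norm (w - x) < norm (w + x)" by (rule power2_less_imp_less) simp
    then show ?thesis using nz[OF that] by (simp add: norm_divide)
  qed
  have cd: "?c (?d w) = w" if "0 < Re w" for w
  proof -
    have "1 - ?d w = 2 * x / (w + x)" "1 + ?d w = 2 * w / (w + x)"
      using nz[OF that] by (simp_all add: field_simps)
    then show ?thesis using nz[OF that] x by simp
  qed
  have inj: "inj_on ?d S"
    by (rule inj_on_inverseI[where g = ?c]) (use cd S in blast)
  have "norm ((G \<circ> ?c) 0) \<le> (\<Prod>a\<in>?d ` S. norm a)"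
  proof (rule disc_zeros_product_bound)
    show "?d ` S \<subseteq> ball 0 1" using d1 S by auto
    have "?c holomorphic_on ball 0 1"
      by (intro holomorphic_intros) auto
    then show "G \<circ> ?c holomorphic_on ball 0 1"
      by (rule holomorphic_on_compose_gen[OF _ hol]) (use Re_c in auto)
    show "norm ((G \<circ> ?c) z) \<le> 1" if "norm z < 1" for z
      unfolding o_def by (rule bound[OF Re_c[OF that]])
    show "(G \<circ> ?c) a = 0" if "a \<in> ?d ` S" for a
      using that S cd by (auto simp del: times_divide_eq_right)
  qed (use assms in auto)
  then show ?thesis
    by (simp add: prod.reindex[OF inj])
qed

text \<open>On the right half-plane this is comparable to the defect \<open>1 - |(w - x) / (w + x)|\<close> for every fixed \<open>x > 0\<close>; its
  summability over a set is therefore the Blaschke condition, with no base point singled out.\<close>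

definition blaschke_weight :: "complex \<Rightarrow> real" where
  "blaschke_weight w = Re w / (1 + (norm w)\<^sup>2)"

lemma norm_plus_of_real_power2_le:
  fixes w :: complex and x :: real
  shows "(norm (w + of_real x))\<^sup>2 \<le> 2 * (1 + x\<^sup>2) * (1 + (norm w)\<^sup>2)"
proof -
  have "(norm (w + of_real x))\<^sup>2 = (Re w + x)\<^sup>2 + (Im w)\<^sup>2"
    by (simp add: cmod_power2)
  also have "\<dots> \<le> 2 * (1 + x\<^sup>2) * (1 + ((Re w)\<^sup>2 + (Im w)\<^sup>2))"
  proof -
    have "(Re w + x)\<^sup>2 \<le> 2 * (Re w)\<^sup>2 + 2 * x\<^sup>2"
      using zero_le_power2[of "Re w - x"] by (simp add: power2_eq_square algebra_simps)
    moreover have "0 \<le> x\<^sup>2 * (Re w)\<^sup>2" "0 \<le> x\<^sup>2 * (Im w)\<^sup>2" by simp_all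
    moreover have "0 \<le> (Im w)\<^sup>2" by simp
    ultimately show ?thesis by (simp only: distrib_left distrib_right mult_1 mult_1_right mult.assoc)
  qed
  finally show ?thesis unfolding cmod_power2 .
qed

lemma one_minus_pseudodist:
  fixes x :: real and w :: complex
  assumes "0 < Re w" "0 < x"
  shows "1 - (norm ((w - x) / (w + x)))\<^sup>2 \<ge> 2 * x / (1 + x\<^sup>2) * blaschke_weight w"
proof -
  have "w + x \<noteq> 0" using assms by (auto simp: complex_eq_iff)
  then have pos: "(norm (w + x))\<^sup>2 > 0" by simp
  have "1 - (norm ((w - x) / (w + x)))\<^sup>2 = ((norm (w + x))\<^sup>2 - (norm (w - x))\<^sup>2) / (norm (w + x))\<^sup>2"
    using pos unfolding norm_divide power_divide by (simp add: diff_divide_distrib)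
  also have "(norm (w + x))\<^sup>2 - (norm (w - x))\<^sup>2 = 4 * x * Re w"
    unfolding cmod_power2 by (simp add: power2_eq_square algebra_simps)
  finally have eq: "1 - (norm ((w - x) / (w + x)))\<^sup>2 = 4 * x * Re w / (norm (w + x))\<^sup>2" .
  have "4 * x * Re w / (2 * (1 + x\<^sup>2) * (1 + (norm w)\<^sup>2)) \<le> 4 * x * Re w / (norm (w + x))\<^sup>2"
    by (rule divide_left_mono[OF norm_plus_of_real_power2_le]) 
       (use assms pos in \<open>auto intro!: mult_pos_pos add_pos_nonneg simp: add_nonneg_eq_0_iff\<close>)
  moreover have "4 * x * Re w / (2 * (1 + x\<^sup>2) * (1 + (norm w)\<^sup>2)) = 2 * x / (1 + x\<^sup>2) * blaschke_weight w"
  proof -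
    have "4 * x * r / (2 * p * q) = 2 * x / p * (r / q)" for p q r :: real
      by (simp add: divide_simps)
    then show ?thesis unfolding blaschke_weight_def .
  qed
  ultimately show ?thesis unfolding eq by simp
qed

lemma blaschke_weight_nonneg: "0 \<le> Re w \<Longrightarrow> 0 \<le> blaschke_weight w"
  by (simp add: blaschke_weight_def)

text \<open>The square of each factor in the product bound is at most \<open>exp\<close> of a negative constant times the
  weight, so unbounded finite sums of weights give arbitrarily small products.\<close>

lemma halfplane_blaschke_uniqueness:
  fixes x :: real and S :: "complex set"
  assumes S: "\<And>w. w \<in> S \<Longrightarrow> 0 < Re w \<and> G w = 0"
    and hol: "G holomorphic_on {w. 0 < Re w}"
    and bound: "\<And>w. 0 < Re w \<Longrightarrow> norm (G w) \<le> M"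
    and div: "\<not> blaschke_weight summable_on S" and x: "0 < x"
  shows "G x = 0"
proof (rule ccontr)
  assume nz: "G x \<noteq> 0"
  have M: "M > 0" using bound[of x] x nz by (smt (verit) Re_complex_of_real zero_less_norm_iff)
  define c where "c = 2 * x / (1 + x\<^sup>2)"
  have c: "c > 0" using x by (simp add: c_def add_pos_nonneg)
  define g where "g = norm (G x) / M"
  have g: "g > 0" using nz M by (simp add: g_def)
  have "sum blaschke_weight F \<le> - 2 * ln g / c" if F: "F \<subseteq> S" "finite F" for F
  proof -
    have "norm (G x / M) \<le> (\<Prod>w\<in>F. norm ((w - x) / (w + x)))"
      by (rule halfplane_zeros_product_bound[of F "\<lambda>w. G w / M"])
         (use F S hol bound M x in \<open>auto intro!: holomorphic_intros simp: norm_divide\<close>)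
    then have "g \<le> (\<Prod>w\<in>F. norm ((w - x) / (w + x)))"
      using M by (simp add: g_def norm_divide)
    then have "g\<^sup>2 \<le> (\<Prod>w\<in>F. norm ((w - x) / (w + x)))\<^sup>2"
      using g by (intro power_mono) auto
    also have "\<dots> = (\<Prod>w\<in>F. (norm ((w - x) / (w + x)))\<^sup>2)"
      by (simp add: prod_power_distrib)
    also have "\<dots> \<le> (\<Prod>w\<in>F. exp (- c * blaschke_weight w))"
    proof (intro prod_mono conjI)
      fix w assume "w \<in> F"
      then have "(norm ((w - x) / (w + x)))\<^sup>2 \<le> 1 + (- c * blaschke_weight w)"
        using one_minus_pseudodist[of w x] S F x by (auto simp: c_def)
      also have "\<dots> \<le> exp (- c * blaschke_weight w)" by (rule exp_ge_add_one_self)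
      finally show "(norm ((w - x) / (w + x)))\<^sup>2 \<le> exp (- c * blaschke_weight w)" .
    qed auto
    also have "\<dots> = exp (- c * sum blaschke_weight F)"
      using F by (simp add: exp_sum sum_distrib_left)
    finally have "ln (g\<^sup>2) \<le> - c * sum blaschke_weight F"
      using g by (metis ln_exp ln_mono zero_less_power)
    then show ?thesis using c g by (simp add: field_simps ln_realpow)
  qed
  then have "blaschke_weight summable_on S"
    by (intro nonneg_bdd_above_summable_on bdd_aboveI)
       (use S in \<open>auto intro: blaschke_weight_nonneg less_imp_le\<close>)
  with div show False ..
qed

section \<open>Integration by parts in the Laplace integral\<close>

lemma exp_integral_Icc:
  fixes a :: complex and s t :: real
  assumes "a \<noteq> 0" "s \<le> t"
  shows "(LBINT u:{s..t}. exp (- a * of_real u)) = (exp (- a * of_real s) - exp (- a * of_real t)) / a"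
proof -
  have "((\<lambda>u. - exp (- a * of_real u) / a) has_vector_derivative exp (- a * of_real u)) (at u within {s..t})" for u
    using assms by (auto intro!: derivative_eq_intros has_vector_derivative_real_field)
  then have "((\<lambda>u. exp (- a * of_real u)) has_integral (- exp (- a * of_real t) / a - - exp (- a * of_real s) / a)) {s..t}"
    using assms by (intro fundamental_theorem_of_calculus) auto
  moreover have "set_integrable lborel {s..t} (\<lambda>u. exp (- a * of_real u))"
    by (intro borel_integrable_atLeastAtMost' continuous_intros)
  ultimately show ?thesis
    by (simp add: set_borel_integral_eq_integral(2) integral_unique diff_divide_distrib)
qed

lemma set_integrable_exp_mult:
  fixes f :: "real \<Rightarrow> complex" and z :: complex
  assumes f: "set_integrable lebesgue {0..t} f"
  shows "set_integrable lebesgue {0..t} (\<lambda>s. exp (- z * of_real s) * f s)"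
  unfolding set_integrable_def
proof (rule Bochner_Integration.integrable_bound)
  let ?a = "\<lambda>s. indicat_real {0..t} s *\<^sub>R f s"
  have a: "integrable lebesgue ?a" using f by (simp add: set_integrable_def)
  then show "integrable lebesgue (\<lambda>s. exp (norm z * t) * norm (?a s))"
    by (intro integrable_mult_right integrable_norm)
  have eq: "indicat_real {0..t} s *\<^sub>R (exp (- z * of_real s) * f s) = exp (- z * of_real s) * ?a s" for s
    by simp
  have "(\<lambda>s. exp (- z * complex_of_real s)) \<in> borel_measurable lebesgue"
    by (rule measurable_completion) simp
  then show "(\<lambda>s. indicat_real {0..t} s *\<^sub>R (exp (- z * of_real s) * f s)) \<in> borel_measurable lebesgue"
    unfolding eq using a by (intro borel_measurable_times) auto
  have "norm (exp (- z * of_real s)) \<le> exp (norm z * t)" if "s \<in> {0..t}" for s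
  proof -
    have "- Re z * s \<le> norm z * t"
      using that abs_Re_le_cmod[of z] by (intro mult_mono) auto
    then show ?thesis by (simp add: norm_exp_eq_Re)
  qed
  then show "AE s in lebesgue. norm (indicat_real {0..t} s *\<^sub>R (exp (- z * of_real s) * f s)) \<le> norm (exp (norm z * t) * norm (?a s))"
    by (intro AE_I2) (auto simp: indicator_def norm_mult intro!: mult_right_mono)
qed

lemma sigma_finite_lebesgue: "sigma_finite_measure (lebesgue :: real measure)"
proof
  let ?A = "range (\<lambda>n. {- real n..real n})"
  have "\<Union>?A = space lebesgue"
  proof (intro equalityI subsetI)
    fix x :: real
    obtain n where "\<bar>x\<bar> \<le> real n" using real_arch_simple by blast
    then show "x \<in> \<Union>?A" by (auto simp: abs_le_iff intro!: exI[of _ n])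
  qed simp
  then show "\<exists>A::real set set. countable A \<and> A \<subseteq> sets lebesgue \<and> \<Union>A = space lebesgue \<and> (\<forall>a\<in>A. emeasure lebesgue a \<noteq> \<infinity>)"
    by (intro exI[of _ ?A]) auto
qed

text \<open>The function \<open>k\<close> is only integrable, so its primitive \<open>K\<close> need not be differentiable; Fubini's theorem on
  the triangle \<open>0 \<le> s \<le> u \<le> t\<close> takes the place of the product rule.\<close>

lemma laplace_integration_by_parts:
  fixes k :: "real \<Rightarrow> complex" and w :: complex
  assumes k: "set_integrable lebesgue {0..t} k" and w: "w \<noteq> 0" and t: "0 \<le> t"
    and K_meas [measurable]: "K \<in> borel_measurable borel"
    and K: "\<And>u. 0 \<le> u \<Longrightarrow> u \<le> t \<Longrightarrow> K u = (LINT s:{0..u}|lebesgue. k s)"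
  shows "(LINT s:{0..t}|lebesgue. exp (- w * of_real s) * k s)
    = exp (- w * of_real t) * K t + w * (LBINT u:{0..t}. exp (- w * of_real u) * K u)"
proof -
  interpret leb: sigma_finite_measure "lebesgue :: real measure" by (rule sigma_finite_lebesgue)
  interpret P: pair_sigma_finite "lebesgue :: real measure" "lborel :: real measure" ..
  define a where "a s = indicat_real {0..t} s *\<^sub>R k s" for s
  have a: "integrable lebesgue a" using k by (simp add: a_def[abs_def] set_integrable_def)
  then have [measurable]: "a \<in> borel_measurable lebesgue" by auto
  have le_meas [measurable]: "Measurable.pred (lebesgue \<Otimes>\<^sub>M lborel) (\<lambda>p::real \<times> real. fst p \<le> snd p)"
  proof -
    have "(\<lambda>x::real. x) \<in> borel_measurable lebesgue"
      by (rule measurable_completion) simp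
    then have "(\<lambda>p::real \<times> real. fst p) \<in> borel_measurable (lebesgue \<Otimes>\<^sub>M lborel)"
      by (rule measurable_compose[OF measurable_fst])
    moreover have "(\<lambda>p::real \<times> real. snd p) \<in> borel_measurable (lebesgue \<Otimes>\<^sub>M lborel)"
      by (rule measurable_compose[OF measurable_snd]) simp
    ultimately show ?thesis unfolding Measurable.pred_def by (rule borel_measurable_le)
  qed
  define b where "b u = indicat_real {0..t} u *\<^sub>R exp (- w * of_real u)" for u
  have b: "integrable lborel b"
  proof -
    have "set_integrable lborel {0..t} (\<lambda>u. exp (- w * of_real u))"
      by (intro borel_integrable_atLeastAtMost' continuous_intros)
    then show ?thesis by (simp add: b_def[abs_def] set_integrable_def)
  qed
  then have [measurable]: "b \<in> borel_measurable lborel" by auto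
  define g where "g s u = (if s \<le> u then a s * b u else 0)" for s u :: real
  have g_meas: "case_prod g \<in> borel_measurable (lebesgue \<Otimes>\<^sub>M lborel)"
    unfolding g_def split_beta' by measurable
  have "integrable (lebesgue \<Otimes>\<^sub>M lborel) (\<lambda>(s, u). a s * b u)"
  proof (rule P.Fubini_integrable)
    show "integrable lebesgue (\<lambda>s. LBINT u. norm (case (s, u) of (s, u) \<Rightarrow> a s * b u))"
      using a by (simp add: norm_mult)
    show "AE s in lebesgue. integrable lborel (\<lambda>u. case (s, u) of (s, u) \<Rightarrow> a s * b u)"
      using b by simp
  qed measurable
  then have int_g: "integrable (lebesgue \<Otimes>\<^sub>M lborel) (case_prod g)"
    by (rule Bochner_Integration.integrable_bound[OF _ g_meas]) (auto simp: g_def)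
  have "(LBINT u:{0..t}. exp (- w * of_real u) * K u) = (LBINT u. (LINT s|lebesgue. g s u))"
    unfolding set_lebesgue_integral_def
  proof (rule Bochner_Integration.integral_cong[OF refl])
    fix u :: real
    show "indicat_real {0..t} u *\<^sub>R (exp (- w * of_real u) * K u) = (LINT s|lebesgue. g s u)"
    proof (cases "u \<in> {0..t}")
      case True
      have "g s u = indicat_real {0..u} s *\<^sub>R k s * b u" for s
        using True by (auto simp: g_def a_def indicator_def)
      then have "(LINT s|lebesgue. g s u) = (LINT s:{0..u}|lebesgue. k s) * b u"
        unfolding set_lebesgue_integral_def by (simp only: integral_mult_left_zero)
      then show ?thesis using True K[of u] by (simp add: b_def)
    next
      case False
      then have "b u = 0" by (simp add: b_def)
      then have "g s u = 0" for s by (simp add: g_def)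
      then show ?thesis using False by simp
    qed
  qed
  also have "\<dots> = (LINT s|lebesgue. (LBINT u. g s u))"
    using P.Fubini_integral[OF int_g] by simp
  also have "\<dots> = (LINT s|lebesgue. indicat_real {0..t} s *\<^sub>R (exp (- w * of_real s) * k s - exp (- w * of_real t) * k s) / w)"
  proof (rule Bochner_Integration.integral_cong[OF refl])
    fix s :: real
    show "(LBINT u. g s u) = indicat_real {0..t} s *\<^sub>R (exp (- w * of_real s) * k s - exp (- w * of_real t) * k s) / w"
    proof (cases "s \<in> {0..t}")
      case True
      have "g s u = k s * (indicat_real {s..t} u *\<^sub>R exp (- w * of_real u))" for u
        using True by (auto simp: g_def a_def b_def indicator_def)
      then have "(LBINT u. g s u) = k s * (LBINT u:{s..t}. exp (- w * of_real u))"
        unfolding set_lebesgue_integral_def by (simp only: integral_mult_right_zero)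
      also have "(LBINT u:{s..t}. exp (- w * of_real u)) = (exp (- w * of_real s) - exp (- w * of_real t)) / w"
        using True by (intro exp_integral_Icc w) simp
      finally show ?thesis using True by (simp add: algebra_simps diff_divide_distrib)
    next
      case False
      then have "g s u = 0" for u by (simp add: g_def a_def)
      then show ?thesis using False by simp
    qed
  qed
  also have "\<dots> = ((LINT s:{0..t}|lebesgue. exp (- w * of_real s) * k s) - exp (- w * of_real t) * K t) / w"
  proof -
    have int_e: "integrable lebesgue (\<lambda>s. indicat_real {0..t} s *\<^sub>R (exp (- w * of_real s) * k s))"
      using set_integrable_exp_mult[OF k] by (simp add: set_integrable_def)
    have "(LINT s|lebesgue. indicat_real {0..t} s *\<^sub>R (exp (- w * of_real s) * k s) - exp (- w * of_real t) * a s)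
      = (LINT s:{0..t}|lebesgue. exp (- w * of_real s) * k s) - exp (- w * of_real t) * (LINT s|lebesgue. a s)"
      using Bochner_Integration.integral_diff[OF int_e integrable_mult_right[OF a, of "exp (- w * of_real t)"]]
      by (simp only: integral_mult_right_zero set_lebesgue_integral_def)
    moreover have "(LINT s|lebesgue. a s) = K t"
      using K[of t] t by (simp add: a_def set_lebesgue_integral_def)
    moreover have "indicat_real {0..t} s *\<^sub>R (exp (- w * of_real s) * k s - exp (- w * of_real t) * k s)
      = indicat_real {0..t} s *\<^sub>R (exp (- w * of_real s) * k s) - exp (- w * of_real t) * a s" for s
      by (simp add: a_def algebra_simps)
    ultimately show ?thesis by simp
  qed
  finally show ?thesis using w by (simp add: field_simps)
qed

lemma set_integral_Icc_continuous:
  fixes k :: "real \<Rightarrow> complex"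
  assumes "locally_integrable k"
  shows "continuous_on UNIV (\<lambda>t. LINT s:{0..t}|lebesgue. k s)"
proof -
  let ?K = "\<lambda>t. LINT s:{0..t}|lebesgue. k s"
  have k: "k absolutely_integrable_on {0..t}" for t
    using assms by (cases "0 \<le> t") (auto simp: locally_integrable_def)
  have K: "?K t = integral {0..t} k" for t
    by (rule set_lebesgue_integral_eq_integral(2)[OF k])
  have "continuous_on {0..real n} ?K" for n
    unfolding K by (intro indefinite_integral_continuous_1 set_lebesgue_integral_eq_integral(1) k)
  moreover have "continuous_on {..0} ?K"
  proof (rule continuous_on_eq[OF continuous_on_const])
    fix t :: real assume "t \<in> {..0}"
    then show "0 = ?K t"
      unfolding K by (cases "t = 0") auto
  qed
  ultimately have *: "continuous_on ({..0} \<union> {0..real n}) ?K" for n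
    by (intro continuous_on_closed_Un) auto
  show ?thesis
  proof (subst continuous_on_eq_continuous_at[OF open_UNIV], rule ballI)
    fix t :: real
    obtain n where n: "t < real n" "0 < n" using reals_Archimedean2[of "max t 1"] by auto
    have "{..0} \<union> {0..real n} = {..real n}" by auto
    then have "isCont ?K t"
      using continuous_on_interior[OF *[of n], of t] n by simp
    then show "continuous (at t) ?K" .
  qed
qed

section \<open>Laplace transforms of bounded continuous functions\<close>

lemma exp_decay_integral_Ici:
  fixes \<eta> :: real
  assumes "0 < \<eta>"
  shows "set_integrable lborel {c..} (\<lambda>s. exp (- \<eta> * s))"
    and "(LBINT s:{c..}. exp (- \<eta> * s)) = exp (- \<eta> * c) / \<eta>"
proof -
  have I: "((\<lambda>s. exp (- \<eta> * s)) has_integral exp (- \<eta> * c) / \<eta>) {c..}"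
    by (rule has_integral_exp_minus_to_infinity[OF assms])
  then have "(\<lambda>s. exp (- \<eta> * s)) absolutely_integrable_on {c..}"
    by (intro nonnegative_absolutely_integrable_1) (auto intro: has_integral_integrable)
  then show *: "set_integrable lborel {c..} (\<lambda>s. exp (- \<eta> * s))"
    unfolding set_integrable_def by (subst (asm) integrable_completion) auto
  show "(LBINT s:{c..}. exp (- \<eta> * s)) = exp (- \<eta> * c) / \<eta>"
    using set_borel_integral_eq_integral(2)[OF *] I by (simp add: integral_unique)
qed

text \<open>A merely conditionally convergent Laplace integral becomes, after integration by parts, the
  absolutely convergent integral \<open>G\<close> of a bounded continuous function.\<close>

context
  fixes K :: "real \<Rightarrow> complex" and M :: real and G :: "complex \<Rightarrow> complex"
  assumes K_cont: "continuous_on UNIV K"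
    and K_bound: "\<And>t. 0 \<le> t \<Longrightarrow> norm (K t) \<le> M"
  defines "G \<equiv> \<lambda>w. LBINT s:{0..}. exp (- w * of_real s) * K s"
begin

lemma K_measurable [measurable]: "K \<in> borel_measurable borel"
  using K_cont by (rule borel_measurable_continuous_onI)

lemma norm_laplace_integrand_le:
  "0 \<le> s \<Longrightarrow> norm (exp (- w * of_real s) * K s) \<le> M * exp (- Re w * s)"
  using K_bound[of s] by (simp add: norm_mult norm_exp_eq_Re)

lemma laplace_integrand_integrable:
  assumes "0 < Re w"
  shows "set_integrable lborel {0..} (\<lambda>s. exp (- w * of_real s) * K s)"
  unfolding set_integrable_def
proof (rule Bochner_Integration.integrable_bound)
  show "integrable lborel (\<lambda>s. M * (indicat_real {0..} s *\<^sub>R exp (- Re w * s)))"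
    using exp_decay_integral_Ici(1)[OF assms] by (intro integrable_mult_right) (simp add: set_integrable_def)
  have "0 \<le> M" using K_bound[of 0] norm_ge_zero order_trans by blast
  then show "AE s in lborel. norm (indicat_real {0..} s *\<^sub>R (exp (- w * of_real s) * K s))
      \<le> norm (M * (indicat_real {0..} s *\<^sub>R exp (- Re w * s)))"
    using norm_laplace_integrand_le[of _ w] by (intro AE_I2) (auto simp: indicator_def abs_mult)
qed measurable

lemma laplace_tail_bound:
  assumes w: "0 < Re w" and t: "0 \<le> t"
  shows "norm (G w - (LBINT s:{0..t}. exp (- w * of_real s) * K s)) \<le> M * (exp (- Re w * t) / Re w)"
proof -
  let ?f = "\<lambda>s. exp (- w * of_real s) * K s"
  have int: "integrable lborel (\<lambda>s. indicat_real {0..} s *\<^sub>R ?f s)"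
    using laplace_integrand_integrable[OF w] by (simp add: set_integrable_def)
  have int': "integrable lborel (\<lambda>s. indicat_real {0..t} s *\<^sub>R ?f s)"
    by (rule Bochner_Integration.integrable_bound[OF int]) (auto simp: indicator_def)
  have int_e: "integrable lborel (\<lambda>s. M * (indicat_real {t..} s *\<^sub>R exp (- Re w * s)))"
    using exp_decay_integral_Ici(1)[OF w] by (intro integrable_mult_right) (simp add: set_integrable_def)
  have M: "0 \<le> M" using K_bound[of 0] norm_ge_zero order_trans by blast
  have "G w - (LBINT s:{0..t}. ?f s) = (LBINT s. indicat_real {0..} s *\<^sub>R ?f s - indicat_real {0..t} s *\<^sub>R ?f s)"
    unfolding G_def set_lebesgue_integral_def
    by (rule Bochner_Integration.integral_diff[OF int int', symmetric])
  also have "norm \<dots> \<le> (LBINT s. M * (indicat_real {t..} s *\<^sub>R exp (- Re w * s)))"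
  proof (rule Bochner_Integration.integral_norm_bound_integral)
    show "norm (indicat_real {0..} s *\<^sub>R ?f s - indicat_real {0..t} s *\<^sub>R ?f s)
        \<le> M * (indicat_real {t..} s *\<^sub>R exp (- Re w * s))" for s
      using norm_laplace_integrand_le[of s w] M t by (auto simp: indicator_def)
  qed (use int int' int_e in auto)
  also have "\<dots> = M * (exp (- Re w * t) / Re w)"
    using exp_decay_integral_Ici(2)[OF w, of t] by (simp add: set_lebesgue_integral_def)
  finally show ?thesis .
qed

lemma laplace_bounded_norm_le:
  assumes w: "0 < Re w"
  shows "norm (G w) \<le> M / Re w"
proof -
  have "(LBINT s:{0..0::real}. exp (- w * of_real s) * K s) = 0"
    unfolding set_lebesgue_integral_def
    by (rule integral_eq_zero_AE) (use AE_lborel_singleton[of 0] in \<open>auto elim!: eventually_mono\<close>)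
  then show ?thesis using laplace_tail_bound[OF w, of 0] by simp
qed

lemma laplace_bounded_limit:
  assumes w: "0 < Re w"
  shows "((\<lambda>t. LBINT s:{0..t}. exp (- w * of_real s) * K s) \<longlongrightarrow> G w) at_top"
proof (rule LIM_zero_cancel, rule Lim_null_comparison)
  show "\<forall>\<^sub>F t in at_top. norm ((LBINT s:{0..t}. exp (- w * of_real s) * K s) - G w) \<le> M * (exp (- Re w * t) / Re w)"
    using eventually_ge_at_top[of 0]
    by eventually_elim (metis laplace_tail_bound[OF w] norm_minus_commute)
  show "((\<lambda>t. M * (exp (- Re w * t) / Re w)) \<longlongrightarrow> 0) at_top"
  proof (rule tendsto_mult_right_zero)
    show "((\<lambda>t. exp (- Re w * t) / Re w) \<longlongrightarrow> 0) at_top" using w by real_asymp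
  qed
qed

lemma laplace_bounded_holomorphic: "G holomorphic_on {w. 0 < Re w}"
proof (rule holomorphic_uniform_sequence[OF open_halfspace_Re_gt])
  fix n :: nat
  show "(\<lambda>w. integral (cbox 0 (real n)) (\<lambda>s. exp (- w * of_real s) * K s)) holomorphic_on {w. 0 < Re w}"
  proof (rule leibniz_rule_holomorphic)
    show "((\<lambda>w. exp (- w * of_real s) * K s) has_field_derivative - of_real s * exp (- w * of_real s) * K s) (at w within {w. 0 < Re w})" for w s
      by (auto intro!: derivative_eq_intros)
    show "(\<lambda>s. exp (- w * of_real s) * K s) integrable_on cbox 0 (real n)" for w
      by (intro integrable_continuous continuous_intros continuous_on_subset[OF K_cont]) auto
    show "continuous_on ({w. 0 < Re w} \<times> cbox 0 (real n)) (\<lambda>(w, s). - of_real s * exp (- w * of_real s) * K s)"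
      unfolding split_beta' by (intro continuous_intros continuous_on_compose2[OF K_cont]) auto
  qed (rule convex_halfspace_Re_gt)
next
  fix w :: complex assume "w \<in> {w. 0 < Re w}"
  then have w: "0 < Re w" by simp
  define \<eta> where "\<eta> = Re w / 2"
  have \<eta>: "0 < \<eta>" using w by (simp add: \<eta>_def)
  have M: "0 \<le> M" using K_bound[of 0] norm_ge_zero order_trans by blast
  have Re_ge: "\<eta> \<le> Re v" if "v \<in> cball w \<eta>" for v
  proof -
    have "Re w - Re v \<le> norm (w - v)" using complex_Re_le_cmod[of "w - v"] by simp
    also have "\<dots> \<le> \<eta>" using that by (simp add: dist_norm)
    finally show ?thesis by (simp add: \<eta>_def)
  qed
  have "uniform_limit (cball w \<eta>) (\<lambda>n w. integral (cbox 0 (real n)) (\<lambda>s. exp (- w * of_real s) * K s)) G sequentially"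
  proof (rule uniform_limitI)
    fix e :: real assume e: "0 < e"
    have "(\<lambda>n. M * (exp (- \<eta> * real n) / \<eta>)) \<longlonglongrightarrow> 0"
    proof (rule tendsto_mult_right_zero)
      show "(\<lambda>n. exp (- \<eta> * real n) / \<eta>) \<longlonglongrightarrow> 0" using \<eta> by real_asymp
    qed
    then have "\<forall>\<^sub>F n in sequentially. M * (exp (- \<eta> * real n) / \<eta>) < e"
      using e by (rule order_tendstoD(2))
    then show "\<forall>\<^sub>F n in sequentially. \<forall>v\<in>cball w \<eta>. dist (integral (cbox 0 (real n)) (\<lambda>s. exp (- v * of_real s) * K s)) (G v) < e"
    proof eventually_elim
      case (elim n)
      show ?case
      proof
        fix v assume v: "v \<in> cball w \<eta>"
        have v0: "0 < Re v" using Re_ge[OF v] \<eta> by simp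
        have "set_integrable lborel {0..real n} (\<lambda>s. exp (- v * of_real s) * K s)"
          by (intro borel_integrable_atLeastAtMost' continuous_intros continuous_on_subset[OF K_cont]) auto
        then have "integral (cbox 0 (real n)) (\<lambda>s. exp (- v * of_real s) * K s) = (LBINT s:{0..real n}. exp (- v * of_real s) * K s)"
          by (simp add: set_borel_integral_eq_integral(2))
        then have "dist (integral (cbox 0 (real n)) (\<lambda>s. exp (- v * of_real s) * K s)) (G v) \<le> M * (exp (- Re v * real n) / Re v)"
          using laplace_tail_bound[OF v0, of "real n"] by (simp add: dist_norm norm_minus_commute)
        also have "\<dots> \<le> M * (exp (- \<eta> * real n) / \<eta>)"
          using Re_ge[OF v] \<eta> M by (intro mult_left_mono frac_le) (auto intro: mult_right_mono)
        also note elim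
        finally show "dist (integral (cbox 0 (real n)) (\<lambda>s. exp (- v * of_real s) * K s)) (G v) < e" .
      qed
    qed
  qed
  moreover have "cball w \<eta> \<subseteq> {w. 0 < Re w}" using Re_ge \<eta> by fastforce
  ultimately show "\<exists>d>0. cball w d \<subseteq> {w. 0 < Re w} \<and>
      uniform_limit (cball w d) (\<lambda>n w. integral (cbox 0 (real n)) (\<lambda>s. exp (- w * of_real s) * K s)) G sequentially"
    using \<eta> by blast
qed

end

text \<open>Lerch's argument. The substitution \<open>x = exp (- s)\<close> turns the values at integers into moments, so \<open>k\<close> is
  orthogonal to all polynomials in \<open>exp (- s)\<close> under the weight \<open>exp (- 2 s)\<close>. By Weierstrass it is then
  orthogonal to \<open>exp (- s) k(s)\<close>, which forces the integral of \<open>exp (- 3 s) k(s)\<^sup>2\<close> to vanish.\<close>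

lemma laplace_bounded_injective_real:
  fixes k :: "real \<Rightarrow> real"
  assumes cont: "continuous_on UNIV k" and bound: "\<And>t. 0 \<le> t \<Longrightarrow> \<bar>k t\<bar> \<le> M"
    and zero: "\<And>n::nat. 2 \<le> n \<Longrightarrow> (LBINT s:{0..}. exp (- (real n) * s) * k s) = 0" and t: "0 \<le> t"
  shows "k t = 0"
proof -
  have [measurable]: "k \<in> borel_measurable borel"
    using cont by (rule borel_measurable_continuous_onI)
  have M: "0 \<le> M" using bound[of 0] by simp
  have int: "set_integrable lborel {0..} (\<lambda>s. exp (- c * s) * q s)"
    if c: "0 < c" and [measurable]: "q \<in> borel_measurable borel" and q: "\<And>s. 0 \<le> s \<Longrightarrow> \<bar>q s\<bar> \<le> D" for c D :: real and q :: "real \<Rightarrow> real"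
    unfolding set_integrable_def
  proof (rule Bochner_Integration.integrable_bound)
    show "integrable lborel (\<lambda>s. D * (indicat_real {0..} s *\<^sub>R exp (- c * s)))"
      using exp_decay_integral_Ici(1)[OF c] by (intro integrable_mult_right) (simp add: set_integrable_def)
    have "0 \<le> D" using q[of 0] by simp
    then show "AE s in lborel. norm (indicat_real {0..} s *\<^sub>R (exp (- c * s) * q s))
        \<le> norm (D * (indicat_real {0..} s *\<^sub>R exp (- c * s)))"
      using q by (intro AE_I2) (auto simp: indicator_def abs_mult)
  qed measurable
  \<comment> \<open>The factor \<open>x\<close> makes \<open>\<phi>\<close> continuous at \<open>0\<close>, which corresponds to \<open>s = \<infinity>\<close>.\<close>
  define \<phi> where "\<phi> x = (if x \<le> 0 then 0 else x * k (- ln x))" for x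
  have \<phi>_exp: "\<phi> (exp (- s)) = exp (- s) * k s" for s
    by (simp add: \<phi>_def)
  have cont_\<phi>: "continuous_on {0..1} \<phi>"
  proof (subst continuous_on_eq_continuous_within, rule ballI)
    fix x :: real assume x: "x \<in> {0..1}"
    show "continuous (at x within {0..1}) \<phi>"
    proof (cases "x = 0")
      case True
      have "((\<lambda>y. M * y) \<longlongrightarrow> 0) (at 0 within {0..1})"
        by (auto intro!: tendsto_eq_intros)
      moreover have "\<forall>\<^sub>F y in at 0 within {0..1}. norm (\<phi> y) \<le> M * y"
        unfolding eventually_at_filter
      proof (rule always_eventually, intro allI impI)
        fix y :: real assume y: "y \<noteq> 0" "y \<in> {0..1}"
        then have "0 \<le> - ln y" by simp
        then show "norm (\<phi> y) \<le> M * y"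
          using bound[of "- ln y"] y by (simp add: \<phi>_def abs_mult mult.commute mult_right_mono)
      qed
      ultimately have "(\<phi> \<longlongrightarrow> 0) (at 0 within {0..1})"
        by (rule Lim_null_comparison[rotated])
      then show ?thesis
        using True by (simp add: continuous_within \<phi>_def)
    next
      case False
      then have x0: "0 < x" using x by simp
      have "isCont k (- ln x)" using cont by (simp add: continuous_on_eq_continuous_at)
      then have "isCont (\<lambda>x. x * k (- ln x)) x"
        using x0 by (intro continuous_intros isCont_o2[of x "\<lambda>x. - ln x" k]) auto
      moreover have "\<forall>\<^sub>F y in nhds x. \<phi> y = y * k (- ln y)"
        using eventually_nhds_in_open[of "{0<..}" x] x0
        by (auto elim!: eventually_mono simp: \<phi>_def)
      ultimately have "isCont \<phi> x"
        by (simp add: isCont_cong)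
      then show ?thesis by (rule continuous_at_imp_continuous_at_within)
    qed
  qed
  let ?I = "LBINT s:{0..}. exp (- 2 * s) * (k s * \<phi> (exp (- s)))"
  have m\<phi>: "(\<lambda>s. k s * \<phi> (exp (- s))) \<in> borel_measurable borel"
    unfolding \<phi>_exp by measurable
  have b\<phi>: "\<bar>k s * \<phi> (exp (- s))\<bar> \<le> M * M" if "0 \<le> s" for s
  proof -
    have "exp (- s) * \<bar>k s\<bar> \<le> 1 * M" using that bound by (intro mult_mono) auto
    then show ?thesis
      unfolding \<phi>_exp abs_mult using bound[OF that] M by (intro mult_mono) auto
  qed
  have small: "\<bar>?I\<bar> \<le> e * (M / 2)" if e: "0 < e" for e
  proof -
    obtain p where "real_polynomial_function p" and p: "\<And>x. x \<in> {0..1} \<Longrightarrow> \<bar>\<phi> x - p x\<bar> < e"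
      using Stone_Weierstrass_real_polynomial_function[OF compact_Icc cont_\<phi> e] by blast
    then obtain a n where p_eq: "p = (\<lambda>x. \<Sum>i\<le>n. a i * x ^ i)"
      by (auto simp: real_polynomial_function_iff_sum)
    let ?P = "\<lambda>s. exp (- 2 * s) * (k s * p (exp (- s)))"
    have P_sum: "?P s = (\<Sum>i\<le>n. a i * (exp (- real (i + 2) * s) * k s))" for s
    proof -
      have E: "exp (- 2 * s) * exp (- s) ^ i = exp (- real (i + 2) * s)" for i
        unfolding exp_of_nat_mult[symmetric] mult_exp_exp by (simp add: algebra_simps)
      then have term_eq: "a i * (exp (- real (i + 2) * s) * k s) = exp (- 2 * s) * (k s * (a i * exp (- s) ^ i))" for i
        unfolding E[symmetric] by (simp only: mult_ac)
      show ?thesis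
        unfolding p_eq sum_distrib_left by (intro sum.cong refl) (rule term_eq[symmetric])
    qed
    have int_i: "integrable lborel (\<lambda>s. indicat_real {0..} s *\<^sub>R (exp (- real (i + 2) * s) * k s))" for i
      using int[of "real (i + 2)" k M] bound by (simp add: set_integrable_def)
    have P_ind: "indicat_real {0..} s *\<^sub>R ?P s = (\<Sum>i\<le>n. a i * (indicat_real {0..} s *\<^sub>R (exp (- real (i + 2) * s) * k s)))" for s
      unfolding P_sum by (simp add: sum_distrib_left mult.left_commute)
    have P0: "(LBINT s:{0..}. ?P s) = 0" and int_P: "integrable lborel (\<lambda>s. indicat_real {0..} s *\<^sub>R ?P s)"
    proof -
      have "(LBINT s:{0..}. ?P s) = (\<Sum>i\<le>n. a i * (LBINT s:{0..}. exp (- real (i + 2) * s) * k s))"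
        unfolding set_lebesgue_integral_def P_ind
        by (simp only: Bochner_Integration.integral_sum[OF integrable_mult_right[OF int_i]] integral_mult_right_zero)
      also have "\<dots> = 0"
        by (intro sum.neutral ballI) (simp only: zero[OF le_add2] mult_zero_right)
      finally show "(LBINT s:{0..}. ?P s) = 0" .
      show "integrable lborel (\<lambda>s. indicat_real {0..} s *\<^sub>R ?P s)"
        unfolding P_ind by (intro Bochner_Integration.integrable_sum integrable_mult_right int_i)
    qed
    have int_I: "integrable lborel (\<lambda>s. indicat_real {0..} s *\<^sub>R (exp (- 2 * s) * (k s * \<phi> (exp (- s)))))"
      using int[OF _ m\<phi> b\<phi>, of 2] by (simp add: set_integrable_def)
    have "?I = ?I - (LBINT s:{0..}. ?P s)" by (simp only: P0 diff_0_right)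
    also have "\<dots> = (LBINT s. indicat_real {0..} s *\<^sub>R (exp (- 2 * s) * (k s * \<phi> (exp (- s)))) - indicat_real {0..} s *\<^sub>R ?P s)"
      unfolding set_lebesgue_integral_def by (rule Bochner_Integration.integral_diff[OF int_I int_P, symmetric])
    finally have I_eq: "?I = (LBINT s. indicat_real {0..} s *\<^sub>R (exp (- 2 * s) * (k s * \<phi> (exp (- s)))) - indicat_real {0..} s *\<^sub>R ?P s)" .
    have "integrable lborel (\<lambda>s::real. indicat_real {0..} s *\<^sub>R exp (- 2 * s))"
      using exp_decay_integral_Ici(1)[of 2 0] by (simp add: set_integrable_def)
    then have int_e: "integrable lborel (\<lambda>s. e * M * (indicat_real {0..} s *\<^sub>R exp (- 2 * s)))"
      by (rule integrable_mult_right)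
    have le_e: "norm (indicat_real {0..} s *\<^sub>R (exp (- 2 * s) * (k s * \<phi> (exp (- s)))) - indicat_real {0..} s *\<^sub>R ?P s)
          \<le> e * M * (indicat_real {0..} s *\<^sub>R exp (- 2 * s))" for s
      proof (cases "0 \<le> s")
        case True
        have b: "\<bar>k s\<bar> * \<bar>\<phi> (exp (- s)) - p (exp (- s))\<bar> \<le> M * e"
          using bound[OF True] p[of "exp (- s)"] True M by (intro mult_mono) auto
        have eq: "exp (- 2 * s) * (k s * \<phi> (exp (- s))) - ?P s = exp (- 2 * s) * (k s * (\<phi> (exp (- s)) - p (exp (- s))))"
          by (simp only: right_diff_distrib)
        have "\<bar>exp (- 2 * s) * (k s * \<phi> (exp (- s))) - ?P s\<bar> = exp (- 2 * s) * (\<bar>k s\<bar> * \<bar>\<phi> (exp (- s)) - p (exp (- s))\<bar>)"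
          by (simp only: eq abs_mult abs_exp_cancel)
        also have "\<dots> \<le> exp (- 2 * s) * (M * e)"
          by (rule mult_left_mono[OF b]) simp
        also have "\<dots> = e * M * exp (- 2 * s)" by (simp only: mult_ac)
        finally have le: "\<bar>exp (- 2 * s) * (k s * \<phi> (exp (- s))) - ?P s\<bar> \<le> e * M * exp (- 2 * s)" .
        have "indicat_real {0..} s = 1" using True by simp
        from this le show ?thesis by (simp only: scaleR_one real_norm_def)
    qed simp
    have "norm ?I \<le> (LBINT s. e * M * (indicat_real {0..} s *\<^sub>R exp (- 2 * s)))"
      unfolding I_eq
      by (rule Bochner_Integration.integral_norm_bound_integral[OF Bochner_Integration.integrable_diff[OF int_I int_P] int_e le_e])
    also have "\<dots> = e * M * (1 / 2)"
    proof -
      have "(LBINT s:{0..}. exp (- 2 * s :: real)) = 1 / 2"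
        using exp_decay_integral_Ici(2)[of 2 0] by simp
      then show ?thesis
        unfolding set_lebesgue_integral_def by (simp only: integral_mult_right_zero)
    qed
    finally show ?thesis by simp
  qed
  have I0: "?I = 0"
  proof -
    have "\<bar>?I\<bar> \<le> 0"
    proof (rule field_le_epsilon)
      fix e :: real assume e: "0 < e"
      then have "0 < e / (M + 1)" using M by simp
      from small[OF this] have "\<bar>?I\<bar> \<le> e / (M + 1) * (M / 2)" .
      also have "\<dots> \<le> e" using e M by (simp add: field_simps)
      finally show "\<bar>?I\<bar> \<le> 0 + e" by simp
    qed
    then show ?thesis by simp
  qed
  let ?q = "\<lambda>s. exp (- 3 * s) * (k s)\<^sup>2"
  have q_eq: "exp (- 2 * s) * (k s * \<phi> (exp (- s))) = ?q s" for s
  proof -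
    have E: "exp (- 2 * s) * exp (- s) = exp (- 3 * s)" by (simp add: mult_exp_exp)
    show ?thesis unfolding \<phi>_exp power2_eq_square E[symmetric] by (simp only: mult_ac)
  qed
  have q_int: "set_integrable lborel {0..} ?q"
    using int[OF _ m\<phi> b\<phi>, of 2] unfolding q_eq by simp
  have "(?q has_integral 0) {0..}"
    using set_borel_integral_eq_integral[OF q_int] I0 unfolding q_eq
    by (simp add: has_integral_iff)
  then have "integral {0..t + 1} ?q \<le> 0"
    using t by (intro integral_subset_le[of "{0..t + 1}" "{0..}" ?q, THEN order_trans])
       (auto simp: has_integral_iff intro!: integrable_continuous_real continuous_intros continuous_on_subset[OF cont])
  moreover have q_on: "?q integrable_on {0..t + 1}"
    by (intro integrable_continuous_real continuous_intros continuous_on_subset[OF cont]) auto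
  moreover have "0 \<le> integral {0..t + 1} ?q"
    by (intro integral_nonneg q_on) auto
  ultimately have "(?q has_integral 0) (cbox 0 (t + 1))"
    by (simp add: has_integral_iff)
  then have "?q t = 0"
    using t by (intro has_integral_0_cbox_imp_0[of 0 "t + 1" ?q t] continuous_intros continuous_on_subset[OF cont]) auto
  then show ?thesis by simp
qed

lemma laplace_bounded_injective:
  fixes K :: "real \<Rightarrow> complex"
  assumes cont: "continuous_on UNIV K" and bound: "\<And>t. 0 \<le> t \<Longrightarrow> norm (K t) \<le> M"
    and zero: "\<And>n::nat. 2 \<le> n \<Longrightarrow> (LBINT s:{0..}. exp (- of_nat n * of_real s) * K s) = 0" and t: "0 \<le> t"
  shows "K t = 0"
proof -
  have re: "(LBINT s:{0..}. exp (- (real n) * s) * Re (K s)) = 0 \<and> (LBINT s:{0..}. exp (- (real n) * s) * Im (K s)) = 0"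
    if n: "2 \<le> n" for n
  proof -
    let ?f = "\<lambda>s. indicat_real {0..} s *\<^sub>R (exp (- of_nat n * of_real s) * K s)"
    have int: "integrable lborel ?f"
      using laplace_integrand_integrable[OF cont bound, of "of_nat n"] n by (simp add: set_integrable_def)
    have e: "exp (- of_nat n * of_real s) = complex_of_real (exp (- (real n) * s))" for s
      by (simp flip: exp_of_real)
    have "(LBINT s. Re (?f s)) = 0" "(LBINT s. Im (?f s)) = 0"
      using integral_Re[OF int] integral_Im[OF int] zero[OF n] by (simp_all add: set_lebesgue_integral_def)
    then show ?thesis
      unfolding e by (simp add: set_lebesgue_integral_def)
  qed
  have "Re (K t) = 0"
    by (rule laplace_bounded_injective_real[of "\<lambda>t. Re (K t)" M])
       (use re t order_trans[OF abs_Re_le_cmod bound] in \<open>auto intro!: continuous_intros cont\<close>)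
  moreover have "Im (K t) = 0"
    by (rule laplace_bounded_injective_real[of "\<lambda>t. Im (K t)" M])
       (use re t order_trans[OF abs_Im_le_cmod bound] in \<open>auto intro!: continuous_intros cont\<close>)
  ultimately show ?thesis by (simp add: complex_eq_iff)
qed

section \<open>Transforms with too many zeros vanish\<close>

text \<open>The half-lines generate the Borel sets and are closed under intersection, so the integral of \<open>f\<close>
  vanishes over every measurable subset of a bounded interval.\<close>

lemma integral_Icc_zero_imp_AE_zero:
  fixes f :: "real \<Rightarrow> complex"
  assumes f: "locally_integrable f"
    and zero: "\<And>t. 0 \<le> t \<Longrightarrow> (LINT s:{0..t}|lebesgue. f s) = 0"
  shows "AE t in lebesgue. t \<ge> 0 \<longrightarrow> f t = 0"
proof -
  have "AE t in lebesgue. indicat_real {0..real n} t *\<^sub>R f t = 0" for n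
  proof (rule sigma_finite_measure.density_zero[OF sigma_finite_lebesgue])
    let ?g = "\<lambda>t. indicat_real {0..real n} t *\<^sub>R f t"
    show g: "integrable lebesgue ?g"
      using f by (simp add: locally_integrable_def set_integrable_def)
    have set_g: "set_integrable lebesgue A ?g" if "A \<in> sets lebesgue" for A
      unfolding set_integrable_def by (rule integrable_mult_indicator[OF that g])
    have stable: "Int_stable (range (\<lambda>a::real. {..a}))"
      by (auto simp: Int_stable_def Int_atMost)
    have subset_Pow: "range (\<lambda>a::real. {..a}) \<subseteq> Pow UNIV" by simp
    have borel: "(LINT t:A|lebesgue. ?g t) = 0" if "A \<in> sigma_sets UNIV (range (\<lambda>a::real. {..a}))" for A
      using stable subset_Pow that
    proof (induction A rule: sigma_sets_induct_disjoint)
      case (basic A)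
      then obtain a where A: "A = {..a}" by auto
      show ?case
      proof (cases "0 \<le> min a (real n)")
        case True
        have eq: "indicat_real A t *\<^sub>R ?g t = indicat_real {0..min a (real n)} t *\<^sub>R f t" for t
          by (auto simp: A indicator_def)
        show ?thesis using zero[OF True] unfolding set_lebesgue_integral_def eq .
      next
        case False
        then have eq: "indicat_real A t *\<^sub>R ?g t = 0" for t
          by (auto simp: A indicator_def)
        show ?thesis unfolding set_lebesgue_integral_def eq by simp
      qed
    next
      case empty
      show ?case by (simp add: set_lebesgue_integral_def)
    next
      case (compl A)
      have A: "A \<in> sets lebesgue"
        using compl(1) by (auto simp: borel_eq_atMost[where 'a=real] sets_lborel)
      have "(LINT t:UNIV - A|lebesgue. ?g t) = (LINT t|lebesgue. ?g t - indicat_real A t *\<^sub>R ?g t)"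
        unfolding set_lebesgue_integral_def
        by (intro Bochner_Integration.integral_cong[OF refl]) (auto simp: indicator_def)
      also have "\<dots> = (LINT t|lebesgue. ?g t) - (LINT t:A|lebesgue. ?g t)"
        using Bochner_Integration.integral_diff[OF g set_g[OF A, unfolded set_integrable_def]]
        by (simp only: set_lebesgue_integral_def)
      also have "\<dots> = 0"
        using compl(2) zero[of "real n"] by (simp add: set_lebesgue_integral_def)
      finally show ?case .
    next
      case (union A)
      have A: "A i \<in> sets lebesgue" for i
      proof -
        have "A i \<in> sigma_sets UNIV (range (\<lambda>a::real. {..a}))" using union(2) by blast
        then have "A i \<in> sets borel" by (simp add: borel_eq_atMost[where 'a=real])
        then show ?thesis by simp
      qed
      have "(LINT t:(\<Union>i. A i)|lebesgue. ?g t) = (\<Sum>i. (LINT t:A i|lebesgue. ?g t))"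
        using A union(1) by (intro lebesgue_integral_countable_add set_g) (auto simp: disjoint_family_on_def)
      also have "\<dots> = 0" using union(3) by simp
      finally show ?case .
    qed
    show "(LINT t:A|lebesgue. ?g t) = 0" if A_sets: "A \<in> sets lebesgue" for A
    proof -
      obtain S N N' where A: "A = S \<union> N" "N \<subseteq> N'" "N' \<in> null_sets lborel" "S \<in> sets lborel"
        by (rule sets_completionE[OF A_sets])
      have "S \<in> sigma_sets UNIV (range (\<lambda>a::real. {..a}))"
        using A(4) by (simp add: borel_eq_atMost[where 'a=real])
      then have "(LINT t:S|lebesgue. ?g t) = 0" by (rule borel)
      moreover have "(LINT t:A|lebesgue. ?g t) = (LINT t:S|lebesgue. ?g t)"
      proof (rule set_integral_cong_set)
        show "set_borel_measurable lebesgue S ?g" "set_borel_measurable lebesgue A ?g"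
          using set_g[OF A_sets] set_g[of S] A(4) unfolding set_integrable_def set_borel_measurable_def by auto
        have "AE t in lebesgue. t \<notin> N'"
          using A(3) by (intro AE_not_in null_sets_completionI)
        then show "AE t in lebesgue. (t \<in> S) = (t \<in> A)"
          by eventually_elim (use A(1,2) in auto)
      qed
      ultimately show ?thesis by simp
    qed
  qed
  then have "AE t in lebesgue. \<forall>n. indicat_real {0..real n} t *\<^sub>R f t = 0"
    by (simp only: AE_all_countable) blast
  then show ?thesis
  proof eventually_elim
    case (elim t)
    obtain n where "t \<le> real n" using real_arch_simple by blast
    then show ?case using elim[rule_format, of n] by (auto simp: indicator_def)
  qed
qed

text \<open>With \<open>K\<close> the primitive of \<open>exp (- z\<^sub>0 s) f(s)\<close>, which is bounded because it converges at infinity,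
  the transform of \<open>f\<close> at \<open>z\<close> is \<open>w G(w)\<close> with \<open>w = z - z\<^sub>0\<close> and \<open>G\<close> the transform of \<open>K\<close>. The bound
  \<open>M / Re w\<close> for \<open>G\<close> degenerates on the imaginary axis; hence the shift by \<open>z\<^sub>0 + 1\<close> instead of \<open>z\<^sub>0\<close>.\<close>

theorem laplace_blaschke_uniqueness:
  fixes f :: "real \<Rightarrow> complex" and S :: "complex set"
  assumes f: "locally_integrable f" and z0: "has_laplace_transform f z0 L"
    and S: "\<And>z. z \<in> S \<Longrightarrow> Re z0 + 1 < Re z \<and> has_laplace_transform f z 0"
    and div: "\<not> blaschke_weight summable_on (\<lambda>z. z - (z0 + 1)) ` S"
  shows "AE t in lebesgue. t \<ge> 0 \<longrightarrow> f t = 0"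
proof -
  define k where "k s = exp (- z0 * of_real s) * f s" for s
  define K where "K t = (LINT s:{0..t}|lebesgue. k s)" for t
  have k: "locally_integrable k"
    using f set_integrable_exp_mult unfolding locally_integrable_def k_def[abs_def] by blast
  have K_cont: "continuous_on UNIV K"
    unfolding K_def[abs_def] by (rule set_integral_Icc_continuous[OF k])
  then have K_meas: "K \<in> borel_measurable borel"
    by (rule borel_measurable_continuous_onI)
  have K_lim: "(K \<longlongrightarrow> L) at_top"
    using z0 by (simp add: has_laplace_transform_def K_def[abs_def] k_def[abs_def])
  obtain M where M: "\<And>t. 0 \<le> t \<Longrightarrow> norm (K t) \<le> M"
  proof -
    have "\<forall>\<^sub>F t in at_top. dist (K t) L < 1" using tendstoD[OF K_lim] by simp
    then obtain T where T: "\<And>t. T \<le> t \<Longrightarrow> dist (K t) L < 1"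
      by (auto simp: eventually_at_top_linorder)
    have "compact (K ` {0..T})"
      by (rule compact_continuous_image[OF continuous_on_subset[OF K_cont]]) auto
    then obtain D where D: "\<And>t. t \<in> {0..T} \<Longrightarrow> norm (K t) \<le> D"
      using compact_imp_bounded by (force simp: bounded_iff)
    have "norm (K t) \<le> max D (norm L + 1)" if "0 \<le> t" for t
    proof (cases "t \<le> T")
      case True
      then show ?thesis using D[of t] that by simp
    next
      case False
      then have "norm (K t - L) < 1" using T[of t] by (simp add: dist_norm)
      then have "norm (K t) \<le> norm L + 1" using norm_triangle_ineq2[of "K t" L] by linarith
      then show ?thesis by simp
    qed
    then show thesis by (rule that)
  qed
  define G where "G w = (LBINT s:{0..}. exp (- w * of_real s) * K s)" for w
  have G_hol: "G holomorphic_on {w. 0 < Re w}"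
    unfolding G_def[abs_def] by (rule laplace_bounded_holomorphic[OF K_cont M])
  have M0: "0 \<le> M" using M[of 0] norm_ge_zero order_trans by blast
  have G_zero: "G (z - z0) = 0" if z: "z \<in> S" for z
  proof -
    let ?w = "z - z0"
    have w: "0 < Re ?w" "?w \<noteq> 0" using S[OF z] by auto
    have "((\<lambda>t. exp (- ?w * of_real t) * K t + ?w * (LBINT u:{0..t}. exp (- ?w * of_real u) * K u)) \<longlongrightarrow> 0 * L + ?w * G ?w) at_top"
    proof (intro tendsto_intros K_lim)
      show "((\<lambda>t. exp (- ?w * of_real t)) \<longlongrightarrow> 0) at_top"
      proof (rule tendsto_norm_zero_cancel)
        have "((\<lambda>t. exp (- Re ?w * t)) \<longlongrightarrow> 0) at_top" using w(1) by real_asymp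
        then show "((\<lambda>t. norm (exp (- ?w * of_real t))) \<longlongrightarrow> 0) at_top"
          by (simp add: norm_exp_eq_Re)
      qed
      show "((\<lambda>t. LBINT u:{0..t}. exp (- ?w * of_real u) * K u) \<longlongrightarrow> G ?w) at_top"
        unfolding G_def by (rule laplace_bounded_limit[OF K_cont M w(1)])
    qed
    moreover have "\<forall>\<^sub>F t in at_top. exp (- ?w * of_real t) * K t + ?w * (LBINT u:{0..t}. exp (- ?w * of_real u) * K u)
        = (LINT s:{0..t}|lebesgue. exp (- z * of_real s) * f s)"
      using eventually_ge_at_top[of 0]
    proof eventually_elim
      case (elim t)
      have kt: "set_integrable lebesgue {0..t} k"
        using k elim by (simp add: locally_integrable_def)
      have "exp (- z * of_real s) * f s = exp (- ?w * of_real s) * k s" for s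
        unfolding k_def mult.assoc[symmetric] mult_exp_exp by (simp add: algebra_simps)
      then show ?case
        using laplace_integration_by_parts[OF kt w(2) elim K_meas] by (simp add: K_def)
    qed
    ultimately have "((\<lambda>t. LINT s:{0..t}|lebesgue. exp (- z * of_real s) * f s) \<longlongrightarrow> 0 * L + ?w * G ?w) at_top"
      by (rule Lim_transform_eventually)
    then have "0 * L + ?w * G ?w = 0"
      using S[OF z] tendsto_unique[OF trivial_limit_at_top_linorder]
      unfolding has_laplace_transform_def by blast
    then show ?thesis using w(2) by simp
  qed
  define F where "F v = G (v + 1)" for v
  have F0: "F (of_real x) = 0" if x: "0 < x" for x
  proof (rule halfplane_blaschke_uniqueness[OF _ _ _ div x])
    show "0 < Re w \<and> F w = 0" if "w \<in> (\<lambda>z. z - (z0 + 1)) ` S" for w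
    proof -
      obtain z where z: "z \<in> S" "w = z - (z0 + 1)" using \<open>w \<in> _\<close> by auto
      have "w + 1 = z - z0" by (simp add: z(2))
      then show ?thesis using S[OF z(1)] G_zero[OF z(1)] by (simp add: F_def z(2))
    qed
    show "F holomorphic_on {w. 0 < Re w}"
      unfolding F_def[abs_def]
      by (rule holomorphic_on_compose_gen[OF _ G_hol, unfolded o_def]) (auto intro!: holomorphic_intros)
    show "norm (F w) \<le> M" if "0 < Re w" for w
    proof -
      have "norm (G (w + 1)) \<le> M / Re (w + 1)"
        unfolding G_def by (rule laplace_bounded_norm_le[OF K_cont M]) (use that in auto)
      also have "\<dots> \<le> M" using that M0 divide_left_mono[of 1 "Re (w + 1)" M] by simp
      finally show ?thesis by (simp add: F_def)
    qed
  qed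
  have "K t = 0" if "0 \<le> t" for t
  proof (rule laplace_bounded_injective[OF K_cont M _ that])
    fix n :: nat assume "2 \<le> n"
    then have "F (of_real (real n - 1)) = 0" by (intro F0) simp
    then show "(LBINT s:{0..}. exp (- of_nat n * of_real s) * K s) = 0"
      by (simp add: F_def G_def)
  qed
  then have "AE t in lebesgue. t \<ge> 0 \<longrightarrow> k t = 0"
    by (intro integral_Icc_zero_imp_AE_zero[OF k]) (simp add: K_def)
  then show ?thesis by (simp add: k_def)
qed

section \<open>Inverting the Laplace transform on the imaginary axis\<close>

text \<open>Cauchy's theorem for the right half-plane. A primitive \<open>P\<close> of \<open>Q\<close> exists by convexity, and
  \<open>P(\<i>R) - P(-\<i>R)\<close> tends to \<open>0\<close>: along the two chords from \<open>\<plusminus>\<i>R\<close> to \<open>R\<close>, of length at most \<open>2R\<close>, the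
  derivative is of order \<open>1 / R\<^sup>2\<close>.\<close>

lemma integral_imaginary_axis_eq_0:
  assumes hol: "Q holomorphic_on {w. - d < Re w}" and d: "0 < d"
    and decay: "\<And>w. 0 \<le> Re w \<Longrightarrow> R0 \<le> norm w \<Longrightarrow> norm (Q w) \<le> C / (norm w)\<^sup>2"
    and int: "integrable lborel (\<lambda>y. Q (\<i> * of_real y))"
  shows "(LBINT y. Q (\<i> * of_real y)) = 0"
proof -
  let ?U = "{w. - d < Re w}"
  have U: "convex ?U" "open ?U"
    by (simp_all add: convex_halfspace_Re_gt open_halfspace_Re_gt)
  obtain P where P: "\<And>w. w \<in> ?U \<Longrightarrow> (P has_field_derivative Q w) (at w within ?U)"
    using holomorphic_convex_primitive'[OF U hol] by blast
  have P': "(P has_field_derivative Q w) (at w within S)" if "w \<in> ?U" for w S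
    using P[OF that] that U(2) by (metis DERIV_subset at_within_open top_greatest)
  have int_P: "(LBINT y:{-R..R}. Q (\<i> * of_real y)) = - \<i> * (P (\<i> * R) - P (- \<i> * R))" if "R > 0" for R :: real
  proof -
    have "((\<lambda>y. - \<i> * P (\<i> * of_real y)) has_vector_derivative Q (\<i> * of_real y)) (at y within {-R..R})" for y
    proof -
      have "((\<lambda>y. P (\<i> * of_real y)) has_vector_derivative \<i> * Q (\<i> * of_real y)) (at y within {-R..R})"
        by (rule field_vector_diff_chain_within[OF _ P', unfolded o_def])
           (use d in \<open>auto intro!: derivative_eq_intros\<close>)
      then have "((\<lambda>y. - \<i> * P (\<i> * of_real y)) has_vector_derivative - \<i> * (\<i> * Q (\<i> * of_real y))) (at y within {-R..R})"
        by (intro derivative_intros)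
      then show ?thesis by simp
    qed
    then have "((\<lambda>y. Q (\<i> * of_real y)) has_integral (- \<i> * P (\<i> * of_real R) - - \<i> * P (\<i> * of_real (-R)))) {-R..R}"
      using that by (intro fundamental_theorem_of_calculus) auto
    moreover have "set_integrable lborel {-R..R} (\<lambda>y. Q (\<i> * of_real y))"
      using int by (auto simp: set_integrable_def intro: integrable_mult_indicator)
    ultimately show ?thesis
      by (simp add: set_borel_integral_eq_integral(2) integral_unique algebra_simps)
  qed
  have chord: "norm (P u - P v) \<le> 8 * C / R"
    if R: "R > 0" "R \<ge> 2 * R0" and uv: "u = of_real R" "v = \<i> * of_real R \<or> v = - \<i> * of_real R" for R u v
  proof -
    have far: "0 \<le> Re w \<and> R / 2 \<le> norm w" if w: "w \<in> closed_segment u v" for w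
    proof -
      obtain t where t: "0 \<le> t" "t \<le> 1" "w = (1 - t) *\<^sub>R u + t *\<^sub>R v"
        using w by (auto simp: in_segment)
      have "Re w = (1 - t) * R" "\<bar>Im w\<bar> = t * R"
        using t uv R by (auto simp: abs_mult)
      moreover have "R = (1 - t) * R + t * R" by (simp add: algebra_simps)
      ultimately show ?thesis
        using abs_Re_le_cmod[of w] abs_Im_le_cmod[of w] t R by auto
    qed
    have bound: "norm (Q w) \<le> C / (R / 2)\<^sup>2" if w: "w \<in> closed_segment u v" for w
    proof -
      have "norm (Q w) \<le> C / (norm w)\<^sup>2"
        using far[OF w] R by (intro decay) auto
      moreover have "0 \<le> C"
      proof -
        have "0 \<le> C / (norm w)\<^sup>2" using calculation norm_ge_zero order_trans by blast
        moreover have "0 < (norm w)\<^sup>2" using far[OF w] R by (intro zero_less_power) auto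
        ultimately show ?thesis by (simp add: zero_le_divide_iff)
      qed
      moreover have "(R / 2)\<^sup>2 \<le> (norm w)\<^sup>2" "0 < (R / 2)\<^sup>2"
        using far[OF w] R by (auto intro!: power_mono)
      ultimately show ?thesis
        by (meson divide_left_mono mult_pos_pos order_trans less_le_trans)
    qed
    have "norm (P u - P v) \<le> C / (R / 2)\<^sup>2 * norm (u - v)"
    proof (rule field_differentiable_bound[of "closed_segment u v" P Q])
      show "(P has_field_derivative Q w) (at w within closed_segment u v)"
        if "w \<in> closed_segment u v" for w
        using far[OF that] d by (intro P') auto
    qed (use bound in auto)
    also have "norm (u - v) \<le> 2 * R \<and> 0 \<le> 2 * R"
      using uv R norm_triangle_ineq4[of u v] by (auto simp: norm_mult)
    hence "C / (R / 2)\<^sup>2 * norm (u - v) \<le> C / (R / 2)\<^sup>2 * (2 * R)"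
      using bound[of u] by (intro mult_left_mono) (auto intro: order_trans[OF norm_ge_zero])
    also have "\<dots> = 8 * C / R" using R by (simp add: power2_eq_square field_simps)
    finally show ?thesis .
  qed
  have "(\<lambda>n. LBINT y:{- real n..real n}. Q (\<i> * of_real y)) \<longlonglongrightarrow> (LBINT y. Q (\<i> * of_real y))"
    unfolding set_lebesgue_integral_def
  proof (rule integral_dominated_convergence)
    show "integrable lborel (\<lambda>y. norm (Q (\<i> * of_real y)))"
      using int by simp
    show "AE y in lborel. (\<lambda>n. indicat_real {- real n..real n} y *\<^sub>R Q (\<i> * of_real y)) \<longlonglongrightarrow> Q (\<i> * of_real y)"
    proof (rule AE_I2, rule tendsto_eventually)
      fix y :: real
      show "\<forall>\<^sub>F n in sequentially. indicat_real {- real n..real n} y *\<^sub>R Q (\<i> * of_real y) = Q (\<i> * of_real y)"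
        using eventually_ge_at_top[of "nat \<lceil>\<bar>y\<bar>\<rceil>"]
        by eventually_elim (auto simp: indicator_def nat_le_iff ceiling_le_iff)
    qed
  qed (use int in \<open>auto simp: indicator_def\<close>)
  moreover have "(\<lambda>n. LBINT y:{- real n..real n}. Q (\<i> * of_real y)) \<longlonglongrightarrow> 0"
  proof (rule Lim_null_comparison)
    show "\<forall>\<^sub>F n in sequentially. norm (LBINT y:{- real n..real n}. Q (\<i> * of_real y)) \<le> 16 * C / real n"
      using eventually_ge_at_top[of "nat \<lceil>max 1 (2 * R0)\<rceil>"]
    proof eventually_elim
      case (elim n)
      then have n: "real n > 0" "real n \<ge> 2 * R0" by linarith+
      have "norm (P (\<i> * n) - P (- \<i> * n)) \<le> norm (P n - P (\<i> * n)) + norm (P n - P (- \<i> * n))"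
        by (metis dist_norm dist_triangle3)
      also have "\<dots> \<le> 8 * C / n + 8 * C / n"
        by (intro add_mono chord n) auto
      finally show ?case using int_P[OF n(1)] by (simp add: norm_mult)
    qed
    show "(\<lambda>n. 16 * C / real n) \<longlonglongrightarrow> 0" by real_asymp
  qed
  ultimately show ?thesis by (rule LIMSEQ_unique)
qed

lemma locally_integrable_bounded:
  assumes [measurable]: "h \<in> borel_measurable borel" and bound: "\<And>t. norm (h t) \<le> M"
  shows "locally_integrable h"
  unfolding locally_integrable_def set_integrable_def
proof (intro allI impI)
  fix t :: real assume "0 \<le> t"
  have "integrable lborel (\<lambda>s. indicat_real {0..t} s *\<^sub>R h s)"
  proof (rule Bochner_Integration.integrable_bound)
    show "integrable lborel (\<lambda>s. indicat_real {0..t} s * M)"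
      by (intro integrable_mult_left integrable_real_indicator) (auto simp: emeasure_lborel_Icc_eq)
    show "AE s in lborel. norm (indicat_real {0..t} s *\<^sub>R h s) \<le> norm (indicat_real {0..t} s * M)"
      using bound by (intro AE_I2) (auto simp: indicator_def intro: order_trans[OF bound])
  qed simp
  then show "integrable lebesgue (\<lambda>s. indicat_real {0..t} s *\<^sub>R h s)"
    by (simp add: integrable_completion)
qed

text \<open>If \<open>\<phi>\<close> is the restriction of an analytic function \<open>H\<close> to the imaginary axis, \<open>h\<close> is up to the factor
  \<open>2 pi\<close> its inverse Laplace transform, and the value found here is the Cauchy integral of \<open>H\<close> at \<open>z\<close>.\<close>

lemma laplace_transform_of_fourier_integral:
  fixes \<phi> :: "real \<Rightarrow> complex"
  assumes int: "integrable lborel \<phi>"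
  defines "h \<equiv> \<lambda>t. LBINT y. exp (\<i> * of_real (y * t)) * \<phi> y"
  shows "locally_integrable h"
    and "\<And>z. 0 < Re z \<Longrightarrow> has_laplace_transform h z (LBINT y. \<phi> y / (z - \<i> * of_real y))"
proof -
  have [measurable]: "\<phi> \<in> borel_measurable borel" using int by auto
  have meas [measurable]: "h \<in> borel_measurable borel"
    unfolding h_def by measurable
  have e1: "norm (exp (\<i> * complex_of_real r)) = 1" for r by (simp add: norm_exp_eq_Re)
  have int_e: "integrable lborel (\<lambda>y. exp (\<i> * of_real (y * t)) * \<phi> y)" for t
    by (rule Bochner_Integration.integrable_bound[OF int]) (simp_all add: norm_mult e1)
  have bound: "norm (h t) \<le> (LBINT y. norm (\<phi> y))" for t
  proof -
    have "norm (h t) \<le> (LBINT y. norm (exp (\<i> * of_real (y * t)) * \<phi> y))"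
      unfolding h_def by (rule integral_norm_bound)
    then show ?thesis by (simp add: norm_mult e1)
  qed
  show "locally_integrable h"
    using meas bound by (rule locally_integrable_bounded)
  fix z :: complex assume z: "0 < Re z"
  let ?I = "LBINT y. \<phi> y / (z - \<i> * of_real y)"
  have low: "Re z \<le> norm (z - \<i> * of_real y)" for y
    using complex_Re_le_cmod[of "z - \<i> * of_real y"] by simp
  have nz: "z - \<i> * of_real y \<noteq> 0" for y
    using low[of y] z by auto
  have quot: "norm (c / (z - \<i> * of_real y)) \<le> norm c / Re z" for c y
    unfolding norm_divide using low[of y] z by (intro divide_left_mono mult_pos_pos) auto
  have int_q: "integrable lborel (\<lambda>y. exp (\<i> * of_real (y * t)) * \<phi> y / (z - \<i> * of_real y))" for t
  proof (rule Bochner_Integration.integrable_bound)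
    show "integrable lborel (\<lambda>y. norm (\<phi> y) / Re z)" using int by simp
    show "AE y in lborel. norm (exp (\<i> * of_real (y * t)) * \<phi> y / (z - \<i> * of_real y)) \<le> norm (norm (\<phi> y) / Re z)"
      using quot[of "exp (\<i> * of_real (_ * t)) * \<phi> _"] z by (intro AE_I2) (simp add: norm_mult e1)
  qed measurable
  have eq: "(LINT s:{0..t}|lebesgue. exp (- z * of_real s) * h s)
      = ?I - exp (- z * of_real t) * (LBINT y. exp (\<i> * of_real (y * t)) * \<phi> y / (z - \<i> * of_real y))"
    if t: "0 \<le> t" for t
  proof -
    let ?f = "\<lambda>s y. indicat_real {0..t} s *\<^sub>R (exp (- z * of_real s) * (exp (\<i> * of_real (y * s)) * \<phi> y))"
    have "(LINT s:{0..t}|lebesgue. exp (- z * of_real s) * h s) = (LBINT s. indicat_real {0..t} s *\<^sub>R (exp (- z * of_real s) * h s))"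
      unfolding set_lebesgue_integral_def by (rule integral_completion) measurable
    also have "\<dots> = (LBINT s. LBINT y. ?f s y)"
      unfolding h_def using int_e by simp
    also have "\<dots> = (LBINT y. LBINT s. ?f s y)"
    proof (rule lborel_pair.Fubini_integral[symmetric], rule lborel_pair.Fubini_integrable)
      show "integrable lborel (\<lambda>s. LBINT y. norm (case (s, y) of (s, y) \<Rightarrow> ?f s y))"
      proof -
        have "set_integrable lborel {0..t} (\<lambda>s. exp (- Re z * s) * (LBINT y. norm (\<phi> y)))"
          by (intro borel_integrable_atLeastAtMost' continuous_intros)
        then show ?thesis
          by (simp add: norm_mult e1 norm_exp_eq_Re set_integrable_def)
      qed
      show "AE s in lborel. integrable lborel (\<lambda>y. case (s, y) of (s, y) \<Rightarrow> ?f s y)"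
        using int_e by (intro AE_I2) simp
    qed measurable
    also have "\<dots> = (LBINT y. \<phi> y / (z - \<i> * of_real y) - exp (- z * of_real t) * (exp (\<i> * of_real (y * t)) * \<phi> y / (z - \<i> * of_real y)))"
    proof (rule Bochner_Integration.integral_cong[OF refl])
      fix y :: real
      have merge: "exp (- z * of_real s) * exp (\<i> * of_real (y * s)) = exp (- (z - \<i> * of_real y) * of_real s)" for s
        unfolding mult_exp_exp by (simp add: algebra_simps)
      have "(LBINT s. ?f s y) = (LBINT s. (indicat_real {0..t} s *\<^sub>R exp (- (z - \<i> * of_real y) * of_real s)) * \<phi> y)"
        by (intro Bochner_Integration.integral_cong[OF refl]) (simp only: mult.assoc[symmetric] merge mult_scaleR_left)
      also have "\<dots> = (LBINT s:{0..t}. exp (- (z - \<i> * of_real y) * of_real s)) * \<phi> y"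
        unfolding set_lebesgue_integral_def by (rule integral_mult_left_zero)
      also have "\<dots> = (1 - exp (- (z - \<i> * of_real y) * of_real t)) / (z - \<i> * of_real y) * \<phi> y"
        using exp_integral_Icc[OF nz t] by simp
      also have "exp (- (z - \<i> * of_real y) * of_real t) = exp (- z * of_real t) * exp (\<i> * of_real (y * t))"
        by (rule merge[symmetric])
      finally show "(LBINT s. ?f s y) = \<phi> y / (z - \<i> * of_real y) - exp (- z * of_real t) * (exp (\<i> * of_real (y * t)) * \<phi> y / (z - \<i> * of_real y))"
        by (simp add: diff_divide_distrib algebra_simps)
    qed
    also have "\<dots> = ?I - exp (- z * of_real t) * (LBINT y. exp (\<i> * of_real (y * t)) * \<phi> y / (z - \<i> * of_real y))"
      using Bochner_Integration.integral_diff[OF int_q[of 0] integrable_mult_right[OF int_q[of t], of "exp (- z * of_real t)"]]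
      by (simp only: integral_mult_right_zero) simp
    finally show ?thesis .
  qed
  have "((\<lambda>t. exp (- z * of_real t) * (LBINT y. exp (\<i> * of_real (y * t)) * \<phi> y / (z - \<i> * of_real y))) \<longlongrightarrow> 0) at_top"
  proof (rule Lim_null_comparison, rule always_eventually, rule allI)
    fix t :: real
    have "norm (LBINT y. exp (\<i> * of_real (y * t)) * \<phi> y / (z - \<i> * of_real y)) \<le> (LBINT y. norm (\<phi> y) / Re z)"
    proof (rule Bochner_Integration.integral_norm_bound_integral[OF int_q])
      show "norm (exp (\<i> * of_real (y * t)) * \<phi> y / (z - \<i> * of_real y)) \<le> norm (\<phi> y) / Re z" for y
        using quot[of "exp (\<i> * of_real (y * t)) * \<phi> y" y] by (simp add: norm_mult e1)
    qed (use int in simp)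
    then have "exp (- Re z * t) * norm (LBINT y. exp (\<i> * of_real (y * t)) * \<phi> y / (z - \<i> * of_real y))
      \<le> exp (- Re z * t) * (LBINT y. norm (\<phi> y) / Re z)"
      by (rule mult_left_mono) simp
    moreover have "norm (exp (- z * of_real t)) = exp (- Re z * t)"
      by (simp add: norm_exp_eq_Re)
    ultimately show "norm (exp (- z * of_real t) * (LBINT y. exp (\<i> * of_real (y * t)) * \<phi> y / (z - \<i> * of_real y)))
      \<le> exp (- Re z * t) * (LBINT y. norm (\<phi> y) / Re z)"
      by (simp only: norm_mult)
    show "((\<lambda>t. exp (- Re z * t) * (LBINT y. norm (\<phi> y) / Re z)) \<longlongrightarrow> 0) at_top"
    proof (rule tendsto_mult_left_zero)
      show "((\<lambda>t. exp (- Re z * t)) \<longlongrightarrow> 0) at_top" using z by real_asymp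
    qed
  qed
  then have "((\<lambda>t. ?I - exp (- z * of_real t) * (LBINT y. exp (\<i> * of_real (y * t)) * \<phi> y / (z - \<i> * of_real y))) \<longlongrightarrow> ?I - 0) at_top"
    by (intro tendsto_intros)
  then have *: "((\<lambda>t. ?I - exp (- z * of_real t) * (LBINT y. exp (\<i> * of_real (y * t)) * \<phi> y / (z - \<i> * of_real y))) \<longlongrightarrow> ?I) at_top"
    unfolding diff_0_right .
  show "has_laplace_transform h z ?I"
    unfolding has_laplace_transform_def
    by (rule Lim_transform_eventually[OF *], rule eventually_mono[OF eventually_ge_at_top[of 0]], simp only: eq)
qed

section \<open>Blaschke products and failure of uniqueness\<close>

text \<open>The factors are normalised to equal \<open>1\<close> at the origin. Each differs from \<open>1\<close> by
  \<open>- w (1 / \<mu>\<^sub>k + 1 / cnj \<mu>\<^sub>k) / (1 + w / cnj \<mu>\<^sub>k)\<close>, whose numerator is \<open>|w|\<close> times \<open>2 Re \<mu>\<^sub>k / |\<mu>\<^sub>k|\<^sup>2\<close> in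
  modulus, while the denominator stays away from \<open>0\<close>, uniformly in \<open>k\<close>, on bounded subsets of
  \<open>Re w > - \<delta> / 2\<close>. Indices outside \<open>A\<close> get the factor \<open>1\<close>;
  this lets \<open>A\<close> select one index for each value of a sequence with repetitions.\<close>

lemma blaschke_product_exists:
  fixes \<mu> :: "nat \<Rightarrow> complex"
  assumes \<delta>: "0 < \<delta>" and Re\<mu>: "\<And>k. \<delta> \<le> Re (\<mu> k)"
    and sum: "(\<lambda>k. blaschke_weight (\<mu> k)) summable_on A"
  obtains B where "B holomorphic_on {w. - (\<delta> / 2) < Re w}"
    and "\<And>w. 0 \<le> Re w \<Longrightarrow> norm (B w) \<le> 1"
    and "\<And>k. k \<in> A \<Longrightarrow> B (\<mu> k) = 0"
    and "\<And>w. 0 < Re w \<Longrightarrow> w \<notin> \<mu> ` A \<Longrightarrow> B w \<noteq> 0"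
proof -
  let ?U = "{w. - (\<delta> / 2) < Re w}"
  have U: "open ?U" by (rule open_halfspace_Re_gt)
  define b where "b k w = (if k \<in> A then (1 - w / \<mu> k) / (1 + w / cnj (\<mu> k)) else 1)" for k w
  define a where "a k = (if k \<in> A then 2 * Re (\<mu> k) / (norm (\<mu> k))\<^sup>2 else 0)" for k
  have \<mu>0: "\<mu> k \<noteq> 0" for k using Re\<mu>[of k] \<delta> by auto
  have a_nonneg: "0 \<le> a k" for k using Re\<mu>[of k] \<delta> by (simp add: a_def)
  have quot: "1 + w / cnj (\<mu> k) = (cnj (\<mu> k) + w) / cnj (\<mu> k)" for w k
    using \<mu>0[of k] by (simp add: field_simps)
  have nz: "cnj (\<mu> k) + w \<noteq> 0" if "w \<in> ?U" for w k
  proof -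
    have *: "0 < Re (cnj (\<mu> k) + w)" using that Re\<mu>[of k] \<delta> by simp
    show ?thesis
    proof
      assume eq: "cnj (\<mu> k) + w = 0"
      from * show False unfolding eq by simp
    qed
  qed
  have summable_a: "summable a"
  proof -
    have "a k \<le> 2 * (1 + 1 / \<delta>\<^sup>2) * (if k \<in> A then blaschke_weight (\<mu> k) else 0)" for k
    proof -
      let ?n = "(norm (\<mu> k))\<^sup>2"
      have n: "\<delta>\<^sup>2 \<le> ?n" "0 < \<delta>\<^sup>2"
        using Re\<mu>[of k] \<delta> complex_Re_le_cmod[of "\<mu> k"] by (auto intro!: power_mono)
      then have "1 + ?n \<le> (1 + 1 / \<delta>\<^sup>2) * ?n" by (simp add: field_simps)
      then have "Re (\<mu> k) / ?n \<le> (1 + 1 / \<delta>\<^sup>2) * (Re (\<mu> k) / (1 + ?n))"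
      proof -
        have aux: "r / n \<le> c * (r / (1 + n))" if "r * (1 + n) \<le> r * (c * n)" "0 < n" for r n c :: real
          using that by (simp add: divide_simps) (simp add: algebra_simps)
        show ?thesis
        proof (rule aux)
          show "Re (\<mu> k) * (1 + ?n) \<le> Re (\<mu> k) * ((1 + 1 / \<delta>\<^sup>2) * ?n)"
            using \<open>1 + ?n \<le> _\<close> Re\<mu>[of k] \<delta> by (intro mult_left_mono) auto
          show "0 < ?n" using n by (rule less_le_trans[rotated])
        qed
      qed
      then have *: "2 * Re (\<mu> k) / ?n \<le> 2 * (1 + 1 / \<delta>\<^sup>2) * (Re (\<mu> k) / (1 + ?n))"
        by linarith
      show ?thesis
      proof (cases "k \<in> A")
        case True
        show ?thesis unfolding a_def blaschke_weight_def if_P[OF True] by (rule *)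
      qed (simp add: a_def)
    qed
    then have le: "norm (a k) \<le> 2 * (1 + 1 / \<delta>\<^sup>2) * (if k \<in> A then blaschke_weight (\<mu> k) else 0)" for k
      using a_nonneg[of k] by simp
    have "(\<lambda>k. if k \<in> A then blaschke_weight (\<mu> k) else 0) summable_on UNIV
        \<longleftrightarrow> (\<lambda>k. blaschke_weight (\<mu> k)) summable_on A"
      by (rule summable_on_cong_neutral) auto
    then have "summable (\<lambda>k. if k \<in> A then blaschke_weight (\<mu> k) else 0)"
      using sum summable_on_imp_summable by blast
    then have "summable (\<lambda>k. 2 * (1 + 1 / \<delta>\<^sup>2) * (if k \<in> A then blaschke_weight (\<mu> k) else 0))"
      by (rule summable_mult)
    then show ?thesis
      by (rule summable_comparison_test') (rule le)
  qed
  have b_bound: "norm (b k w - 1) \<le> R / min (1/2) (\<delta> / (4 * R)) * a k"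
    if w: "w \<in> ?U" "norm w \<le> R" and R: "0 < R" for k w R
  proof (cases "k \<in> A")
    case True
    let ?c = "min (1/2) (\<delta> / (4 * R))" and ?m = "\<mu> k"
    have c: "0 < ?c" using R \<delta> by simp
    have low: "?c \<le> norm (1 + w / cnj ?m)"
    proof (cases "2 * R \<le> norm ?m")
      case True
      have "norm ?m - norm w \<le> norm (cnj ?m + w)"
        using norm_diff_ineq[of "cnj ?m" w] by simp
      then have "1/2 * norm ?m \<le> norm (cnj ?m + w)" using True w by simp
      then have "1/2 \<le> norm (1 + w / cnj ?m)"
        unfolding quot norm_divide using \<mu>0[of k] by (simp add: field_simps)
      then show ?thesis by simp
    next
      case False
      have "\<delta> / 2 \<le> Re (cnj ?m + w)" using w Re\<mu>[of k] by simp
      also have "\<dots> \<le> norm (cnj ?m + w)" by (rule complex_Re_le_cmod)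
      finally have "\<delta> / 2 \<le> norm (cnj ?m + w)" .
      moreover have "\<delta> / (4 * R) * norm ?m \<le> \<delta> / (4 * R) * (2 * R)"
        using False \<delta> R by (intro mult_left_mono) auto
      ultimately have "\<delta> / (4 * R) * norm ?m \<le> norm (cnj ?m + w)" using R by simp
      then have "\<delta> / (4 * R) \<le> norm (1 + w / cnj ?m)"
        unfolding quot norm_divide using \<mu>0[of k] by (simp add: pos_le_divide_eq)
      then show ?thesis by simp
    qed
    have nz': "1 + w / cnj ?m \<noteq> 0" using low c by auto
    have "b k w - 1 = - (w * (1 / ?m + 1 / cnj ?m)) / (1 + w / cnj ?m)"
      using True nz' by (simp add: b_def field_simps)
    also have "1 / ?m + 1 / cnj ?m = of_real (a k)"
      using True \<mu>0[of k] complex_norm_square[of "\<mu> k"]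
      by (simp add: a_def field_simps complex_add_cnj)
    finally have "norm (b k w - 1) = norm w * a k / norm (1 + w / cnj ?m)"
      using a_nonneg[of k] by (simp add: norm_divide norm_mult)
    also have "\<dots> \<le> R * a k / ?c"
      using low c w R a_nonneg[of k] by (intro frac_le mult_right_mono) auto
    finally show ?thesis by simp
  qed (simp add: b_def a_def)
  have hol_b: "b k holomorphic_on ?U" for k
  proof (cases "k \<in> A")
    case True
    have "(\<lambda>w. (1 - w / \<mu> k) / (1 + w / cnj (\<mu> k))) holomorphic_on ?U"
      by (intro holomorphic_intros) (use \<mu>0 nz quot in auto)
    then show ?thesis using True by (simp add: b_def[abs_def])
  qed (simp add: b_def[abs_def])
  define B where "B w = lim (\<lambda>N. \<Prod>n<N. b n w)" for w
  have unif: "uniform_limit K (\<lambda>N w. \<Prod>n<N. b n w) B sequentially" if K: "compact K" "K \<subseteq> ?U" for K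
  proof -
    obtain R where R: "0 < R" "\<And>w. w \<in> K \<Longrightarrow> norm w \<le> R"
      using compact_imp_bounded[OF K(1)] by (auto simp: bounded_pos)
    have "uniformly_convergent_on K (\<lambda>N w. \<Prod>n<N. b n w)"
    proof (rule uniformly_convergent_on_prod'[OF _ K(1)])
      show "continuous_on K (b n)" for n
        using hol_b K(2) by (meson continuous_on_subset holomorphic_on_imp_continuous_on)
      show "uniformly_convergent_on K (\<lambda>N w. \<Sum>n<N. norm (b n w - 1))"
      proof (rule Weierstrass_m_test'[OF _ summable_mult[OF summable_a, of "R / min (1/2) (\<delta> / (4 * R))"]])
        show "norm (norm (b n w - 1)) \<le> R / min (1/2) (\<delta> / (4 * R)) * a n" if "w \<in> K" for n w
          unfolding real_norm_def abs_norm_cancel using that K(2) by (intro b_bound R) auto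
      qed
    qed
    then show ?thesis
      unfolding B_def uniformly_convergent_uniform_limit_iff .
  qed
  have lim: "(\<lambda>N. \<Prod>n<N. b n w) \<longlonglongrightarrow> B w" if "w \<in> ?U" for w
    by (rule tendsto_uniform_limitI[OF unif[of "{w}"]]) (use that in auto)
  show thesis
  proof
    show "B holomorphic_on ?U"
    proof (rule holomorphic_uniform_sequence[OF U])
      show "(\<lambda>w. \<Prod>n<N. b n w) holomorphic_on ?U" for N
        by (intro holomorphic_intros hol_b)
      show "\<exists>d>0. cball w d \<subseteq> ?U \<and> uniform_limit (cball w d) (\<lambda>N w. \<Prod>n<N. b n w) B sequentially"
        if "w \<in> ?U" for w
        using open_contains_cball_eq[OF U] that unif by (metis compact_cball)
    qed
  next
    fix w assume w: "0 \<le> Re w"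
    have "norm (b k w) \<le> 1" for k
    proof (cases "k \<in> A")
      case True
      have "(norm (\<mu> k - w))\<^sup>2 \<le> (norm (cnj (\<mu> k) + w))\<^sup>2"
        unfolding cmod_power2 using w Re\<mu>[of k] \<delta> mult_nonneg_nonneg[of "Re w" "Re (\<mu> k)"]
        by (simp add: power2_eq_square algebra_simps)
      then have "norm (\<mu> k - w) \<le> norm (cnj (\<mu> k) + w)"
        by (rule power2_le_imp_le) simp
      moreover have "norm (b k w) = norm (\<mu> k - w) / norm (cnj (\<mu> k) + w)"
      proof -
        have "1 - w / \<mu> k = (\<mu> k - w) / \<mu> k" using \<mu>0[of k] by (simp add: field_simps)
        then show ?thesis
          using \<mu>0[of k] unfolding b_def if_P[OF True] quot by (simp add: norm_divide norm_mult)
      qed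
      ultimately show ?thesis by (simp add: divide_le_eq_1)
    qed (simp add: b_def)
    then have "norm (\<Prod>n<N. b n w) \<le> 1" for N
      by (simp add: prod_norm[symmetric] prod_le_1)
    then show "norm (B w) \<le> 1"
      by (intro tendsto_upperbound[OF tendsto_norm[OF lim]]) (use w \<delta> in auto)
  next
    fix k assume k: "k \<in> A"
    have "\<mu> k \<in> ?U" using Re\<mu>[of k] \<delta> by simp
    moreover have "(\<lambda>N. \<Prod>n<N. b n (\<mu> k)) \<longlonglongrightarrow> 0"
    proof (rule tendsto_eventually)
      show "\<forall>\<^sub>F N in sequentially. (\<Prod>n<N. b n (\<mu> k)) = 0"
        using eventually_gt_at_top[of k]
        by eventually_elim (use k \<mu>0 in \<open>auto simp: b_def intro!: prod_zero\<close>)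
    qed
    ultimately show "B (\<mu> k) = 0" using lim LIMSEQ_unique by blast
  next
    fix w assume w: "0 < Re w" "w \<notin> \<mu> ` A"
    then have wU: "w \<in> ?U" using \<delta> by simp
    have b0: "b k w \<noteq> 0" for k
      using w \<mu>0[of k] nz[OF wU, of k] by (auto simp: b_def quot)
    have "w \<noteq> 0" using w by auto
    then have "summable (\<lambda>k. norm (b k w - 1))"
      by (intro summable_comparison_test'[OF summable_mult[OF summable_a, of "norm w / min (1/2) (\<delta> / (4 * norm w))"]])
         (use b_bound[OF wU, of "norm w"] in simp)
    then have "convergent_prod (\<lambda>k. b k w)"
      by (intro abs_convergent_prod_imp_convergent_prod summable_imp_abs_convergent_prod)
    then have "(\<lambda>k. b k w) has_prod (\<Prod>k. b k w)" and "(\<Prod>k. b k w) \<noteq> 0"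
      using b0 prodinf_nonzero[of "\<lambda>k. b k w"] by (simp_all add: convergent_prod_has_prod)
    then show "B w \<noteq> 0"
      using lim[OF wU] has_prod_imp_tendsto' LIMSEQ_unique by metis
  qed
qed

lemma integrable_inverse_plus_square:
  fixes x :: real
  assumes "0 < x"
  shows "integrable lborel (\<lambda>y. 1 / (x\<^sup>2 + y\<^sup>2))"
proof -
  have "integrable lborel (\<lambda>y. inverse (1 + y\<^sup>2) :: real)"
    using integrable_inverse_1_plus_square by (simp add: set_integrable_def)
  then have "integrable lborel (\<lambda>y. inverse (1 + (0 + 1 / x * y)\<^sup>2) :: real)"
    using assms by (intro lborel_integrable_real_affine) auto
  then have "integrable lborel (\<lambda>y. 1 / x\<^sup>2 * inverse (1 + (0 + 1 / x * y)\<^sup>2) :: real)"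
    by (rule integrable_mult_right)
  moreover have "1 / x\<^sup>2 * inverse (1 + (0 + 1 / x * y)\<^sup>2) = 1 / (x\<^sup>2 + y\<^sup>2)" for y
    using assms by (simp add: field_simps power_divide)
  ultimately show ?thesis by simp
qed

text \<open>At a zero of \<open>H\<close> the quotient in the Cauchy integral has a removable singularity, so its
  integral along the imaginary axis is zero by Cauchy's theorem.\<close>

lemma cauchy_integral_at_zero:
  assumes hol: "H holomorphic_on {w. - d < Re w}" and d: "0 < d"
    and decay: "\<And>w. 0 \<le> Re w \<Longrightarrow> w \<noteq> 0 \<Longrightarrow> norm (H w) \<le> C / (norm w)\<^sup>2"
    and int: "integrable lborel (\<lambda>y. H (\<i> * of_real y))"
    and a: "0 < Re a" "H a = 0"
  shows "(LBINT y. H (\<i> * of_real y) / (a - \<i> * of_real y)) = 0"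
proof -
  define Q where "Q w = (if w = a then deriv H a else (H w - H a) / (w - a))" for w
  have Q: "Q w = H w / (w - a)" if "w \<noteq> a" for w
    using that a by (simp add: Q_def)
  have ne: "\<i> * complex_of_real y \<noteq> a" for y
    using a by auto
  have low: "Re a \<le> norm (\<i> * of_real y - a)" for y
    using complex_Re_le_cmod[of "a - \<i> * of_real y"] by (simp add: norm_minus_commute)
  have "(LBINT y. Q (\<i> * of_real y)) = 0"
  proof (rule integral_imaginary_axis_eq_0[OF _ d])
    show "Q holomorphic_on {w. - d < Re w}"
      unfolding Q_def by (rule pole_lemma_open[OF hol open_halfspace_Re_gt])
    show "norm (Q w) \<le> C / (norm w)\<^sup>2" if w: "0 \<le> Re w" "norm a + 1 \<le> norm w" for w
    proof -
      have "1 \<le> norm (w - a)" using w norm_triangle_ineq2[of w a] by simp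
      then have "norm (H w) / norm (w - a) \<le> norm (H w)"
        using divide_left_mono[of 1 "norm (w - a)" "norm (H w)"] by (cases "w = a") simp_all
      moreover have "w \<noteq> a" "w \<noteq> 0" using w by (auto, smt (verit) norm_ge_zero norm_zero)
      ultimately show ?thesis
        using decay[OF w(1)] by (fastforce simp add: Q norm_divide)
    qed
    show "integrable lborel (\<lambda>y. Q (\<i> * of_real y))"
    proof (rule Bochner_Integration.integrable_bound)
      show "integrable lborel (\<lambda>y. norm (H (\<i> * of_real y)) / Re a)" using int by simp
      have [measurable]: "(\<lambda>y. H (\<i> * of_real y)) \<in> borel_measurable borel" using int by auto
      show "(\<lambda>y. Q (\<i> * of_real y)) \<in> borel_measurable lborel"
        by (simp add: Q[OF ne])
      show "AE y in lborel. norm (Q (\<i> * of_real y)) \<le> norm (norm (H (\<i> * of_real y)) / Re a)"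
        using low a(1) by (intro AE_I2) (simp add: Q[OF ne] norm_divide frac_le)
    qed
  qed
  moreover have "H (\<i> * of_real y) / (a - \<i> * of_real y) = - Q (\<i> * of_real y)" for y
    using Q[OF ne] by (metis minus_diff_eq minus_divide_right)
  ultimately show ?thesis by simp
qed

text \<open>If the weights were summable, let \<open>B\<close> be the Blaschke product of the values of \<open>l\<close> and
  \<open>H(w) = B(w) / (w + x)\<^sup>2\<close>. The function \<open>h\<close> obtained from \<open>H\<close> by Fourier inversion has a
  transform that vanishes at every \<open>l k\<close>. It does not vanish at \<open>x\<close>: there the function
  \<open>B - B(x)\<close> contributes nothing to the Cauchy integral, while the constant \<open>B(x)\<close>, which is not zero,
  contributes \<open>B(x)\<close> times the integral of \<open>1 / ((x + \<i>y)\<^sup>2 (x - \<i>y))\<close>, whose real part is positive.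
  So \<open>h\<close> contradicts uniqueness.\<close>

theorem uniqueness_imp_blaschke_divergence:
  assumes uniq: "laplace_uniqueness_sequence l"
    and \<delta>: "0 < \<delta>" and Re_l: "\<And>k. \<delta> \<le> Re (l k)"
  shows "\<not> blaschke_weight summable_on range l"
proof
  assume sum: "blaschke_weight summable_on range l"
  obtain A where A: "inj_on l A" "range l = l ` A"
    using subset_image_inj[of "range l" l UNIV] by auto
  have "(\<lambda>k. blaschke_weight (l k)) summable_on A"
    using sum summable_on_reindex[OF A(1), of blaschke_weight] A(2) by (simp add: o_def)
  then obtain B where hol_B: "B holomorphic_on {w. - (\<delta> / 2) < Re w}"
    and B1: "\<And>w. 0 \<le> Re w \<Longrightarrow> norm (B w) \<le> 1"
    and "\<And>k. k \<in> A \<Longrightarrow> B (l k) = 0"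
    and "\<And>w. 0 < Re w \<Longrightarrow> w \<notin> l ` A \<Longrightarrow> B w \<noteq> 0"
    using blaschke_product_exists[of \<delta> l A] \<delta> Re_l by blast
  then have B0: "B (l k) = 0" and B_nz: "0 < Re w \<Longrightarrow> w \<notin> range l \<Longrightarrow> B w \<noteq> 0" for k w
    using A(2) by (metis image_iff rangeI)+
  \<comment> \<open>Half of \<open>\<delta>\<close> lies to the left of all zeros, but still in the right half-plane.\<close>
  define x where "x = \<delta> / 2"
  have x: "0 < x" using \<delta> by (simp add: x_def)
  have "B x \<noteq> 0"
  proof (rule B_nz)
    show "complex_of_real x \<notin> range l"
    proof
      assume "complex_of_real x \<in> range l"
      then obtain k where "l k = of_real x" by (metis rangeE)
      then have "Re (l k) = x" by simp
      then show False using Re_l[of k] \<delta> by (simp add: x_def)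
    qed
  qed (use x in simp)
  let ?U = "{w. - x < Re w}"
  have nz: "w + of_real x \<noteq> 0" if "- x < Re w" for w
    using that by (auto simp: complex_eq_iff)
  have norm_ix: "(norm (\<i> * complex_of_real y + of_real x))\<^sup>2 = x\<^sup>2 + y\<^sup>2" for y
    by (simp add: cmod_power2)
  have weight: "(\<lambda>w. F w / (w + of_real x)\<^sup>2) holomorphic_on ?U \<and>
      (\<forall>w. 0 \<le> Re w \<longrightarrow> w \<noteq> 0 \<longrightarrow> norm (F w / (w + of_real x)\<^sup>2) \<le> C / (norm w)\<^sup>2) \<and>
      integrable lborel (\<lambda>y. F (\<i> * of_real y) / (\<i> * of_real y + of_real x)\<^sup>2)"
    if hol: "F holomorphic_on ?U" and C: "\<And>w. 0 \<le> Re w \<Longrightarrow> norm (F w) \<le> C" for F C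
  proof (intro conjI allI impI)
    show "(\<lambda>w. F w / (w + of_real x)\<^sup>2) holomorphic_on ?U"
      using nz by (intro holomorphic_intros hol) auto
    show "norm (F w / (w + of_real x)\<^sup>2) \<le> C / (norm w)\<^sup>2" if w: "0 \<le> Re w" "w \<noteq> 0" for w
    proof -
      have "(norm w)\<^sup>2 \<le> (norm (w + of_real x))\<^sup>2"
        unfolding cmod_power2 using w x by (simp add: power_mono)
      moreover have "0 \<le> C" using C[OF w(1)] norm_ge_zero order_trans by blast
      ultimately show ?thesis
        using w(2) C[OF w(1)] unfolding norm_divide norm_power by (intro frac_le) auto
    qed
    show "integrable lborel (\<lambda>y. F (\<i> * of_real y) / (\<i> * of_real y + of_real x)\<^sup>2)"
    proof (rule Bochner_Integration.integrable_bound)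
      show "integrable lborel (\<lambda>y. C * (1 / (x\<^sup>2 + y\<^sup>2)))"
        using integrable_inverse_plus_square[OF x] by (rule integrable_mult_right)
      have "continuous_on UNIV (\<lambda>y. F (\<i> * of_real y) / (\<i> * of_real y + of_real x)\<^sup>2)"
        using x nz hol
        by (intro continuous_intros continuous_on_compose2[OF holomorphic_on_imp_continuous_on[OF hol]]) auto
      then show "(\<lambda>y. F (\<i> * of_real y) / (\<i> * of_real y + of_real x)\<^sup>2) \<in> borel_measurable lborel"
        by (simp add: borel_measurable_continuous_onI)
      show "AE y in lborel. norm (F (\<i> * of_real y) / (\<i> * of_real y + of_real x)\<^sup>2) \<le> norm (C * (1 / (x\<^sup>2 + y\<^sup>2)))"
      proof (rule AE_I2)
        fix y
        have "norm (F (\<i> * of_real y)) \<le> C" by (rule C) simp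
        then show "norm (F (\<i> * of_real y) / (\<i> * of_real y + of_real x)\<^sup>2) \<le> norm (C * (1 / (x\<^sup>2 + y\<^sup>2)))"
          by (simp add: norm_divide norm_power norm_ix abs_mult divide_right_mono)
      qed
    qed
  qed
  have hol: "B holomorphic_on ?U" using hol_B by (simp add: x_def)
  define H where "H w = B w / (w + of_real x)\<^sup>2" for w
  define \<phi> where "\<phi> y = H (\<i> * of_real y)" for y
  define h where "h t = (LBINT y. exp (\<i> * of_real (y * t)) * \<phi> y)" for t
  have H: "H holomorphic_on ?U" "\<And>w. 0 \<le> Re w \<Longrightarrow> w \<noteq> 0 \<Longrightarrow> norm (H w) \<le> 1 / (norm w)\<^sup>2" "integrable lborel \<phi>"
    using weight[OF hol B1] unfolding H_def[abs_def] \<phi>_def[abs_def] by auto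
  have h: "locally_integrable h"
    and lap: "\<And>z. 0 < Re z \<Longrightarrow> has_laplace_transform h z (LBINT y. \<phi> y / (z - \<i> * of_real y))"
    using laplace_transform_of_fourier_integral[OF H(3)] unfolding h_def[abs_def] by auto
  have Re_l0: "0 < Re (l k)" for k using Re_l[of k] \<delta> by simp
  have "has_laplace_transform h (l k) 0" for k
    using lap[OF Re_l0] cauchy_integral_at_zero[OF H(1) x H(2) H(3)[unfolded \<phi>_def] Re_l0] B0
    by (simp add: \<phi>_def H_def)
  moreover have "laplace_abscissa h < ereal (Re (l k))" for k
  proof -
    have "laplace_abscissa h \<le> ereal x"
      unfolding laplace_abscissa_def
      using lap[of "of_real x"] x by (intro Inf_lower CollectI exI[of _ "of_real x"]) auto
    also have "ereal x < ereal (Re (l k))" using Re_l[of k] \<delta> by (simp add: x_def)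
    finally show ?thesis .
  qed
  ultimately have "AE t in lebesgue. t \<ge> 0 \<longrightarrow> h t = 0"
    using uniq h unfolding laplace_uniqueness_sequence_def by blast
  then have "(LINT s:{0..t}|lebesgue. exp (- of_real x * of_real s) * h s) = 0" for t
    unfolding set_lebesgue_integral_def
    by (intro integral_eq_zero_AE) (auto elim!: eventually_mono simp: indicator_def)
  then have "has_laplace_transform h x 0"
    by (simp add: has_laplace_transform_def)
  then have I0: "(LBINT y. \<phi> y / (of_real x - \<i> * of_real y)) = 0"
    using lap[of "of_real x"] x tendsto_unique[OF trivial_limit_at_top_linorder]
    unfolding has_laplace_transform_def by auto
  \<comment> \<open>The part of \<open>H\<close> that vanishes at \<open>x\<close> contributes nothing to this Cauchy integral.\<close>
  define E where "E w = (B w - B x) / (w + of_real x)\<^sup>2" for w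
  define \<epsilon> where "\<epsilon> y = 1 / (\<i> * complex_of_real y + of_real x)\<^sup>2" for y
  have "E holomorphic_on ?U \<and> (\<forall>w. 0 \<le> Re w \<longrightarrow> w \<noteq> 0 \<longrightarrow> norm (E w) \<le> 2 / (norm w)\<^sup>2) \<and>
      integrable lborel (\<lambda>y. E (\<i> * of_real y))"
    unfolding E_def[abs_def]
  proof (rule weight)
    show "(\<lambda>w. B w - B x) holomorphic_on ?U" by (intro holomorphic_intros hol)
    show "norm (B w - B x) \<le> 2" if "0 \<le> Re w" for w
      using norm_triangle_ineq4[of "B w" "B x"] B1[OF that] B1[of "of_real x"] x by simp
  qed
  then have E: "E holomorphic_on ?U" "\<And>w. 0 \<le> Re w \<Longrightarrow> w \<noteq> 0 \<Longrightarrow> norm (E w) \<le> 2 / (norm w)\<^sup>2"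
    and intE: "integrable lborel (\<lambda>y. E (\<i> * of_real y))"
    by auto
  have E0: "(LBINT y. E (\<i> * of_real y) / (of_real x - \<i> * of_real y)) = 0"
    by (rule cauchy_integral_at_zero[OF E(1) x E(2) intE]) (use x in \<open>simp_all add: E_def\<close>)
  have cauchy_int: "integrable lborel (\<lambda>y. \<psi> y / (of_real x - \<i> * of_real y))"
    if [measurable]: "integrable lborel \<psi>" for \<psi> :: "real \<Rightarrow> complex"
  proof (rule Bochner_Integration.integrable_bound)
    show "integrable lborel (\<lambda>y. norm (\<psi> y) / x)" using that by simp
    have "x \<le> norm (of_real x - \<i> * complex_of_real y)" for y
      using complex_Re_le_cmod[of "of_real x - \<i> * of_real y"] by simp
    then show "AE y in lborel. norm (\<psi> y / (of_real x - \<i> * of_real y)) \<le> norm (norm (\<psi> y) / x)"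
      using x by (intro AE_I2) (simp add: norm_divide frac_le)
  qed (use that in measurable)
  have int\<epsilon>: "integrable lborel \<epsilon>"
    using weight[of "\<lambda>_. 1" 1] by (simp add: \<epsilon>_def[abs_def])
  have "\<phi> y = E (\<i> * of_real y) + B x * \<epsilon> y" for y
    by (simp add: \<phi>_def H_def E_def \<epsilon>_def diff_divide_distrib)
  then have "(LBINT y. \<phi> y / (of_real x - \<i> * of_real y))
     = (LBINT y. E (\<i> * of_real y) / (of_real x - \<i> * of_real y) + B x * (\<epsilon> y / (of_real x - \<i> * of_real y)))"
    by (simp add: add_divide_distrib)
  also have "\<dots> = B x * (LBINT y. \<epsilon> y / (of_real x - \<i> * of_real y))"
    using Bochner_Integration.integral_add[OF cauchy_int[OF intE]
        integrable_mult_right[OF cauchy_int[OF int\<epsilon>], of "B x"]] E0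
    by (simp only: integral_mult_right_zero add_0)
  finally have "(LBINT y. \<epsilon> y / (of_real x - \<i> * of_real y)) = 0"
    using I0 \<open>B x \<noteq> 0\<close> by simp
  then have "(LBINT y. Re (\<epsilon> y / (of_real x - \<i> * of_real y))) = 0"
    using integral_Re[OF cauchy_int[OF int\<epsilon>]] by simp
  moreover have Re_eq: "Re (\<epsilon> y / (of_real x - \<i> * of_real y)) = x / (x\<^sup>2 + y\<^sup>2)\<^sup>2" for y
  proof -
    have "(\<i> * complex_of_real y + of_real x) * (of_real x - \<i> * of_real y) = of_real (x\<^sup>2 + y\<^sup>2)"
      by (simp add: power2_eq_square algebra_simps)
    then have "(\<i> * complex_of_real y + of_real x)\<^sup>2 * (of_real x - \<i> * of_real y) * (of_real x - \<i> * of_real y) = of_real ((x\<^sup>2 + y\<^sup>2)\<^sup>2)"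
      by (simp add: power2_eq_square algebra_simps)
    moreover have "of_real x - \<i> * complex_of_real y \<noteq> 0" using x by (auto simp: complex_eq_iff)
    ultimately have "\<epsilon> y / (of_real x - \<i> * of_real y) = (of_real x - \<i> * of_real y) / of_real ((x\<^sup>2 + y\<^sup>2)\<^sup>2)"
      unfolding \<epsilon>_def by (metis divide_divide_eq_left mult_divide_mult_cancel_right mult_1)
    then show ?thesis by (simp only: Re_divide_of_real) simp
  qed
  ultimately have "(LBINT y. x / (x\<^sup>2 + y\<^sup>2)\<^sup>2) = 0" by simp
  moreover have "integrable lborel (\<lambda>y. x / (x\<^sup>2 + y\<^sup>2)\<^sup>2)"
    using integrable_Re[OF cauchy_int[OF int\<epsilon>]] by (simp only: Re_eq)
  ultimately have "AE y in lborel. x / (x\<^sup>2 + y\<^sup>2)\<^sup>2 = 0"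
    using x by (subst (asm) integral_nonneg_eq_0_iff_AE) auto
  moreover have "x / (x\<^sup>2 + y\<^sup>2)\<^sup>2 \<noteq> 0" for y
    using x sum_power2_gt_zero_iff[of x y] by simp
  ultimately have "AE y in lborel :: real measure. False" by (simp only: HOL.simp_thms)
  then show False by (simp add: eventually_False trivial_limit_def[symmetric] ae_filter_eq_bot_iff)
qed

section \<open>Powers and the Blaschke condition\<close>

lemma blaschke_weight_le_translate:
  assumes z: "2 * Re c \<le> Re z" "0 \<le> Re z"
  shows "blaschke_weight z \<le> 4 * (1 + (norm c)\<^sup>2) * blaschke_weight (z - c)"
proof -
  have "(norm (z - c))\<^sup>2 \<le> (norm z + norm c)\<^sup>2"
    by (intro power_mono norm_triangle_ineq4) simp
  also have "\<dots> \<le> 2 * (norm z)\<^sup>2 + 2 * (norm c)\<^sup>2"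
    using zero_le_power2[of "norm z - norm c"] by (simp add: power2_eq_square algebra_simps)
  finally have "(norm (z - c))\<^sup>2 \<le> 2 * (norm z)\<^sup>2 + 2 * (norm c)\<^sup>2" .
  then have "1 + (norm (z - c))\<^sup>2 \<le> 2 * (1 + (norm c)\<^sup>2) * (1 + (norm z)\<^sup>2)"
  proof -
    have "2 * (1 + (norm c)\<^sup>2) * (1 + (norm z)\<^sup>2)
        = 2 + 2 * (norm c)\<^sup>2 + 2 * (norm z)\<^sup>2 + 2 * ((norm c)\<^sup>2 * (norm z)\<^sup>2)"
      by (simp add: algebra_simps)
    moreover have "0 \<le> (norm c)\<^sup>2 * (norm z)\<^sup>2" by simp
    ultimately show ?thesis
      using \<open>(norm (z - c))\<^sup>2 \<le> 2 * (norm z)\<^sup>2 + 2 * (norm c)\<^sup>2\<close> by linarith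
  qed
  moreover have pos: "0 < 1 + (norm (z - c))\<^sup>2" "0 < 1 + (norm z)\<^sup>2" "0 < 1 + (norm c)\<^sup>2"
    by (auto intro: add_pos_nonneg)
  ultimately have "(Re z / 2) / (2 * (1 + (norm c)\<^sup>2) * (1 + (norm z)\<^sup>2)) \<le> Re (z - c) / (1 + (norm (z - c))\<^sup>2)"
    using z by (intro frac_le) auto
  then have "4 * (1 + (norm c)\<^sup>2) * ((Re z / 2) / (2 * (1 + (norm c)\<^sup>2) * (1 + (norm z)\<^sup>2)))
      \<le> 4 * (1 + (norm c)\<^sup>2) * (Re (z - c) / (1 + (norm (z - c))\<^sup>2))"
    using pos by (intro mult_left_mono) auto
  moreover have "4 * p * ((r / 2) / (2 * p * q)) = r / q" if "0 < p" for p q r :: real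
    using that by simp
  ultimately show ?thesis using pos by (simp only: blaschke_weight_def)
qed

context
  fixes \<gamma> :: real
  assumes \<gamma>: "0 < \<gamma>" "\<gamma> < 1"
begin

lemma cos_sector_pos: "0 < cos (\<gamma> * (pi / 2))"
  using \<gamma> mult_strict_right_mono[of \<gamma> 1 "pi / 2"] by (intro cos_gt_zero) simp_all

lemma norm_powr_of_real: "norm ((z::complex) powr of_real \<gamma>) = norm z powr \<gamma>"
  by (simp add: norm_powr_real_powr')

text \<open>The argument of \<open>z\<^sup>\<gamma>\<close> is at most \<open>\<gamma> pi / 2\<close> in modulus.\<close>

lemma Re_powr_sector:
  assumes z: "0 < Re z"
  shows "cos (\<gamma> * (pi / 2)) * norm z powr \<gamma> \<le> Re (z powr of_real \<gamma>)"
proof -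
  have z0: "z \<noteq> 0" using z by auto
  have arg: "\<bar>\<gamma> * Im (Ln z)\<bar> \<le> \<gamma> * (pi / 2)"
    unfolding abs_mult using Re_Ln_pos_lt_imp[OF z] \<gamma> by (simp add: mult_left_mono)
  have "\<gamma> * (pi / 2) \<le> pi" using mult_right_mono[of \<gamma> 1 pi] \<gamma> by simp
  then have "cos (\<gamma> * (pi / 2)) \<le> cos \<bar>\<gamma> * Im (Ln z)\<bar>"
    using arg by (intro cos_monotone_0_pi_le) auto
  then have "cos (\<gamma> * (pi / 2)) \<le> cos (\<gamma> * Im (Ln z))" by simp
  moreover have "Re (z powr of_real \<gamma>) = norm z powr \<gamma> * cos (\<gamma> * Im (Ln z))"
    using z0 by (simp add: powr_def Re_exp)
  ultimately show ?thesis
    by (simp add: mult.commute mult_left_mono)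
qed

lemma inj_on_powr_halfplane: "inj_on (\<lambda>z::complex. z powr of_real \<gamma>) {z. 0 < Re z}"
proof (rule inj_onI)
  fix z w :: complex assume *: "z \<in> {z. 0 < Re z}" "w \<in> {z. 0 < Re z}" "z powr of_real \<gamma> = w powr of_real \<gamma>"
  have Ln_powr: "Ln (u powr of_real \<gamma>) = of_real \<gamma> * Ln u" if u: "0 < Re u" for u
  proof -
    have "\<bar>\<gamma> * Im (Ln u)\<bar> < pi"
    proof -
      have "\<gamma> * \<bar>Im (Ln u)\<bar> \<le> 1 * \<bar>Im (Ln u)\<bar>" using \<gamma> by (intro mult_right_mono) auto
      also have "\<dots> < pi" using Re_Ln_pos_lt_imp[OF u] pi_gt_zero by simp
      finally show ?thesis using \<gamma> by (simp add: abs_mult)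
    qed
    moreover have "u \<noteq> 0" using u by auto
    ultimately show ?thesis unfolding powr_def by (auto intro!: Ln_exp simp: abs_less_iff)
  qed
  have "Ln z = Ln w"
    using Ln_powr[of z] Ln_powr[of w] * \<gamma> by simp
  moreover have "z \<noteq> 0" "w \<noteq> 0" using * by auto
  ultimately show "z = w" by (metis exp_Ln)
qed

text \<open>In the sector the weight of \<open>z\<^sup>\<gamma>\<close> is comparable to \<open>r / (1 + r\<^sup>2)\<close> with \<open>r = |z|\<^sup>\<gamma>\<close>. Raising \<open>|z|\<close> to the power
  \<open>\<gamma> < 1\<close> moves it towards \<open>1\<close>, where \<open>r / (1 + r\<^sup>2)\<close> is largest.\<close>

lemma blaschke_weight_le_powr:
  assumes z: "0 < Re z"
  shows "cos (\<gamma> * (pi / 2)) / 2 * blaschke_weight z \<le> blaschke_weight (z powr of_real \<gamma>)"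
proof -
  let ?c = "cos (\<gamma> * (pi / 2))" and ?r = "norm z"
  have r: "0 < ?r" using z by auto
  have re: "Re z \<le> ?r" by (rule complex_Re_le_cmod)
  have den: "0 < 1 + (?r powr \<gamma>)\<^sup>2" "0 < 1 + ?r\<^sup>2" by (auto intro: add_pos_nonneg)
  have "Re z / (2 * (1 + ?r\<^sup>2)) \<le> ?r powr \<gamma> / (1 + (?r powr \<gamma>)\<^sup>2)"
  proof (cases "1 \<le> ?r")
    case True
    have "1 \<le> ?r powr \<gamma>" "?r powr \<gamma> \<le> ?r powr 1"
      using True \<gamma> by (intro ge_one_powr_ge_zero powr_mono; simp)+
    then have g: "1 \<le> ?r powr \<gamma>" "?r powr \<gamma> \<le> ?r" using r by auto
    have "Re z / (2 * (1 + ?r\<^sup>2)) \<le> ?r / (2 * ?r\<^sup>2)"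
      using re r by (intro frac_le) auto
    also have "\<dots> = 1 / (2 * ?r)" using r by (simp add: power2_eq_square)
    also have "\<dots> \<le> 1 / (2 * ?r powr \<gamma>)" using g by (intro frac_le) auto
    also have "\<dots> = ?r powr \<gamma> / (2 * (?r powr \<gamma>)\<^sup>2)" using g by (simp add: power2_eq_square)
    also have "\<dots> \<le> ?r powr \<gamma> / (1 + (?r powr \<gamma>)\<^sup>2)"
      by (intro frac_le den(1)) (use g one_le_power[OF g(1), of 2] in auto)
    finally show ?thesis .
  next
    case False
    then have g: "?r \<le> ?r powr \<gamma>" "?r powr \<gamma> \<le> 1"
      using r \<gamma> powr_mono'[of \<gamma> 1 ?r] by (auto intro: powr_le1)
    have "Re z / (2 * (1 + ?r\<^sup>2)) \<le> ?r powr \<gamma> / 2"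
      using re g z by (intro frac_le) auto
    also have "\<dots> \<le> ?r powr \<gamma> / (1 + (?r powr \<gamma>)\<^sup>2)"
      by (intro frac_le den(1)) (use g power_le_one[OF _ g(2), of 2] in auto)
    finally show ?thesis .
  qed
  then have "?c * (Re z / (2 * (1 + ?r\<^sup>2))) \<le> ?c * (?r powr \<gamma> / (1 + (?r powr \<gamma>)\<^sup>2))"
    using cos_sector_pos by (intro mult_left_mono) auto
  also have "\<dots> \<le> Re (z powr of_real \<gamma>) / (1 + (norm (z powr of_real \<gamma>))\<^sup>2)"
    using Re_powr_sector[OF z] den unfolding norm_powr_of_real times_divide_eq_right
    by (intro divide_right_mono) auto
  finally show ?thesis by (simp add: blaschke_weight_def)
qed

end

lemma summable_on_cofinite_subset:
  fixes g :: "'a \<Rightarrow> real"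
  assumes "g summable_on T" "finite (R - T)" "T \<subseteq> R"
  shows "g summable_on R"
proof -
  have "g summable_on T \<union> (R - T)"
    using assms by (intro summable_on_Un_disjoint) auto
  then show ?thesis using assms(3) by (simp add: Un_absorb1)
qed

text \<open>Each value other than \<open>l 0\<close> is taken at some index \<open>k \<ge> 1\<close>, so finite sums over distinct values are
  dominated by partial sums of the series; the single value \<open>l 0\<close> does not affect divergence.\<close>

lemma partial_sums_at_top_of_range:
  fixes b :: "'a \<Rightarrow> real"
  assumes nonneg: "\<And>k. 0 \<le> b (l k)" and le: "\<And>k. b (l k) \<le> C * u k" and C: "0 < C"
    and div: "\<not> b summable_on range l"
  shows "filterlim (\<lambda>n. \<Sum>k=1..n. u k) at_top sequentially"
  unfolding filterlim_at_top
proof (rule allI, rule ccontr)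
  fix Z assume not_ev: "\<not> (\<forall>\<^sub>F n in sequentially. Z \<le> (\<Sum>k=1..n. u k))"
  have u: "0 \<le> u k" for k
    using order_trans[OF nonneg le] C by (simp add: zero_le_mult_iff)
  have small: "(\<Sum>k=1..n. u k) < Z" for n
  proof (rule ccontr)
    assume n: "\<not> (\<Sum>k=1..n. u k) < Z"
    have "Z \<le> (\<Sum>k=1..m. u k)" if "n \<le> m" for m
    proof -
      have "(\<Sum>k=1..n. u k) \<le> (\<Sum>k=1..m. u k)"
        using that u by (intro sum_mono2) auto
      then show ?thesis using n by simp
    qed
    then show False using not_ev by (auto simp: eventually_sequentially)
  qed
  have "sum b F \<le> C * Z" if F: "F \<subseteq> range l - {l 0}" "finite F" for F
  proof -
    have "F \<subseteq> l ` {1..}"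
    proof
      fix x assume "x \<in> F"
      then obtain k where k: "x = l k" "l k \<noteq> l 0" using F(1) by auto
      then have "k \<noteq> 0" by metis
      then show "x \<in> l ` {1..}" using k by auto
    qed
    then obtain A where A: "A \<subseteq> {1..}" "inj_on l A" "F = l ` A"
      by (auto simp: subset_image_inj)
    then have "finite A" using F(2) finite_imageD by blast
    then obtain n where n: "A \<subseteq> {..n}" using finite_nat_iff_bounded_le by blast
    have "sum b F = (\<Sum>k\<in>A. b (l k))" using A by (simp add: sum.reindex)
    also have "\<dots> \<le> (\<Sum>k\<in>A. C * u k)" by (intro sum_mono le)
    also have "\<dots> \<le> (\<Sum>k=1..n. C * u k)"
      using A(1) n u C by (intro sum_mono2) auto
    also have "\<dots> \<le> C * Z"
      using small[of n] C by (simp flip: sum_distrib_left)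
    finally show ?thesis .
  qed
  then have "b summable_on range l - {l 0}"
    using nonneg by (intro nonneg_bdd_above_summable_on bdd_aboveI[of _ "C * Z"]) auto
  then have "b summable_on range l"
    by (rule summable_on_cofinite_subset) (auto intro: finite_subset[of _ "{l 0}"])
  with div show False ..
qed

theorem corollary2p13:
  fixes l :: "nat \<Rightarrow> complex" and \<gamma> :: real
  assumes "laplace_uniqueness_sequence l"
    and "\<And>k. Re (l k) > 0"
    and "0 < \<gamma>" and "\<gamma> < 1"
    and "filterlim (\<lambda>k. Re (l k)) at_top sequentially"
  shows "laplace_uniqueness_sequence (\<lambda>k. l k powr of_real \<gamma>) \<and>
    filterlim (\<lambda>n. \<Sum>k=1..n. 1 - norm ((l k powr of_real \<gamma> - 1) / (l k powr of_real \<gamma> + 1)))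
      at_top sequentially"
proof
  let ?p = "\<lambda>z::complex. z powr of_real \<gamma>" and ?c = "cos (\<gamma> * (pi / 2))"
  note \<gamma> = assms(3,4)
  have c: "0 < ?c" by (rule cos_sector_pos[OF \<gamma>])
  have Re_p: "0 < Re (?p (l k))" for k
  proof -
    have "0 < ?c * norm (l k) powr \<gamma>"
      using c assms(2)[of k] by (intro mult_pos_pos) auto
    also have "\<dots> \<le> Re (?p (l k))" by (rule Re_powr_sector[OF \<gamma> assms(2)])
    finally show ?thesis .
  qed
  have Re_p_lim: "filterlim (\<lambda>k. Re (?p (l k))) at_top sequentially"
  proof (rule filterlim_at_top_mono)
    have "filterlim (\<lambda>x. ?c * x powr \<gamma>) at_top at_top"
      using c \<gamma> by real_asymp
    then show "filterlim (\<lambda>k. ?c * Re (l k) powr \<gamma>) at_top sequentially"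
      by (rule filterlim_compose[OF _ assms(5)])
    show "\<forall>\<^sub>F k in sequentially. ?c * Re (l k) powr \<gamma> \<le> Re (?p (l k))"
    proof (intro always_eventually allI)
      fix k
      have "?c * Re (l k) powr \<gamma> \<le> ?c * norm (l k) powr \<gamma>"
        using c \<gamma> assms(2)[of k] complex_Re_le_cmod[of "l k"]
        by (intro mult_left_mono powr_mono2) auto
      also have "\<dots> \<le> Re (?p (l k))" by (rule Re_powr_sector[OF \<gamma> assms(2)])
      finally show "?c * Re (l k) powr \<gamma> \<le> Re (?p (l k))" .
    qed
  qed
  obtain \<delta> where \<delta>: "0 < \<delta>" "\<And>k. \<delta> \<le> Re (l k)"
  proof -
    obtain n where n: "\<And>k. n \<le> k \<Longrightarrow> 1 \<le> Re (l k)"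
      using assms(5) by (auto simp: filterlim_at_top eventually_sequentially)
    define \<delta> where "\<delta> = Min (insert 1 ((\<lambda>k. Re (l k)) ` {..<n}))"
    have "0 < \<delta>" unfolding \<delta>_def using assms(2) by (subst Min_gr_iff) auto
    moreover have "\<delta> \<le> Re (l k)" for k
    proof (cases "k < n")
      case True
      then show ?thesis unfolding \<delta>_def by (intro Min_le) auto
    next
      case False
      have "\<delta> \<le> 1" unfolding \<delta>_def by (intro Min_le) auto
      then show ?thesis using n[of k] False by simp
    qed
    ultimately show thesis by (rule that)
  qed
  have div: "\<not> (\<lambda>z. blaschke_weight (?p z)) summable_on range l"
  proof
    assume "(\<lambda>z. blaschke_weight (?p z)) summable_on range l"
    then have "(\<lambda>z. 2 / ?c * blaschke_weight (?p z)) summable_on range l"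
      by (rule summable_on_cmult_right)
    then have "blaschke_weight summable_on range l"
    proof (rule summable_on_comparison_test)
      fix z assume "z \<in> range l"
      then have z: "0 < Re z" using assms(2) by auto
      show "blaschke_weight z \<le> 2 / ?c * blaschke_weight (?p z)"
        using blaschke_weight_le_powr[OF \<gamma> z] c by (simp add: field_simps)
      show "0 \<le> blaschke_weight z" using z by (intro blaschke_weight_nonneg) simp
    qed
    with uniqueness_imp_blaschke_divergence[OF assms(1) \<delta>] show False ..
  qed
  show "filterlim (\<lambda>n. \<Sum>k=1..n. 1 - norm ((?p (l k) - 1) / (?p (l k) + 1))) at_top sequentially"
  proof (rule partial_sums_at_top_of_range[OF _ _ _ div])
    fix k
    show "0 \<le> blaschke_weight (?p (l k))" using Re_p[of k] by (intro blaschke_weight_nonneg) simp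
    let ?q = "norm ((?p (l k) - 1) / (?p (l k) + 1))"
    have "blaschke_weight (?p (l k)) \<le> 1 - ?q\<^sup>2"
      using one_minus_pseudodist[OF Re_p[of k], of 1] by simp
    also have "\<dots> \<le> 2 * (1 - ?q)"
      using zero_le_power2[of "1 - ?q"] by (simp only: power2_diff) simp
    finally show "blaschke_weight (?p (l k)) \<le> 2 * (1 - ?q)" .
  qed simp
  show "laplace_uniqueness_sequence (\<lambda>k. ?p (l k))"
    unfolding laplace_uniqueness_sequence_def
  proof (intro allI impI, elim conjE)
    fix f
    assume f: "locally_integrable f"
      and zeros: "\<forall>k. laplace_abscissa f < ereal (Re (?p (l k))) \<and> has_laplace_transform f (?p (l k)) 0"
    obtain z0 L where z0: "has_laplace_transform f z0 L"
      using zeros unfolding laplace_abscissa_def by (auto simp: Inf_less_iff)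
    let ?d = "z0 + 1"
    define T where "T = {z \<in> range l. max (Re z0 + 1) (2 * Re ?d) < Re (?p z)}"
    have "finite (range l - T)"
    proof -
      have "\<forall>\<^sub>F k in sequentially. max (Re z0 + 1) (2 * Re ?d) < Re (?p (l k))"
        by (rule Re_p_lim[unfolded filterlim_at_top_dense, rule_format])
      then obtain n where n: "\<And>k. n \<le> k \<Longrightarrow> l k \<in> T"
        by (auto simp: T_def eventually_sequentially)
      have "range l - T \<subseteq> l ` {..<n}" using n by (force simp: not_le)
      then show ?thesis by (rule finite_subset) simp
    qed
    moreover have T: "T \<subseteq> range l" by (auto simp: T_def)
    ultimately have div_T: "\<not> (\<lambda>z. blaschke_weight (?p z)) summable_on T"
      using div summable_on_cofinite_subset by blast
    show "AE t in lebesgue. t \<ge> 0 \<longrightarrow> f t = 0"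
    proof (rule laplace_blaschke_uniqueness[OF f z0])
      show "Re z0 + 1 < Re w \<and> has_laplace_transform f w 0" if "w \<in> ?p ` T" for w
        using that zeros by (auto simp: T_def)
      show "\<not> blaschke_weight summable_on (\<lambda>z. z - ?d) ` ?p ` T"
      proof
        assume *: "blaschke_weight summable_on (\<lambda>z. z - ?d) ` ?p ` T"
        have "inj_on ?p T"
          by (rule inj_on_subset[OF inj_on_powr_halfplane[OF \<gamma>]]) (use T assms(2) in auto)
        then have inj: "inj_on (\<lambda>z. ?p z - ?d) T"
          by (simp add: inj_on_def)
        have "(\<lambda>z. blaschke_weight (?p z - ?d)) summable_on T"
          using * summable_on_reindex[OF inj, of blaschke_weight] by (simp add: image_image o_def)
        then have "(\<lambda>z. 4 * (1 + (norm ?d)\<^sup>2) * blaschke_weight (?p z - ?d)) summable_on T"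
          by (rule summable_on_cmult_right)
        then have "(\<lambda>z. blaschke_weight (?p z)) summable_on T"
        proof (rule summable_on_comparison_test)
          fix z assume z: "z \<in> T"
          then have Re_z: "0 \<le> Re (?p z)" using Re_p T by (auto intro: less_imp_le)
          then show "0 \<le> blaschke_weight (?p z)" by (rule blaschke_weight_nonneg)
          show "blaschke_weight (?p z) \<le> 4 * (1 + (norm ?d)\<^sup>2) * blaschke_weight (?p z - ?d)"
            using z Re_z by (intro blaschke_weight_le_translate) (auto simp: T_def)
        qed
        with div_T show False ..
      qed
    qed
  qed
qed

end
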